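(* Let $\lambda>0$, $\beta\in(0,1)$ and $|\rho|<1$. Let $(X_n)$ be a stationary autoregressive process of order 1, $X_n=\rho X_{n-1}+\epsilon_n$, where $(\epsilon_n)_{n\ge1}$ is a sequence of i.i.d. random variables, $\epsilon_n$ is independent of $X_j$ for $j<n$, and every marginal $X_n$ is positive tempered stable, i.e. has Laplace transform $$\mathbb{E}\left(e^{-sX_n}\right)=e^{-\left((s+\lambda)^{\beta}-\lambda^{\beta}\right)}.$$ Then the probability density function $g$ of the innovation term $\epsilon_n$ has the integral form $$ \begin{aligned} g(x)=\;&\frac{1}{2\pi i}\int_{0}^{\infty}\Big( e^{-\lambda x/\rho}\,e^{-wx}\,e^{\rho^\beta w^\beta e^{i\pi\beta}-(we^{i\pi}+\lambda-\lambda/\rho)^\beta}-e^{-\lambda x/\rho}\,e^{-wx}\,e^{\rho^\beta w^\beta e^{-i\pi\beta}-(we^{-i\pi}+\lambda-\lambda/\rho)^\beta}\Big)\,dw\\ &+\frac{1}{2\pi i}\int_{0}^{(\lambda/\rho)-\lambda}\Big(e^{-\lambda x}\,e^{-wx}\,e^{(-\lambda\rho+\rho we^{i\pi}+\lambda)^\beta-(we^{i\pi})^\beta}-e^{-\lambda x}\,e^{-wx}\,e^{(-\lambda\rho+\rho we^{-i\pi}+\lambda)^\beta-(we^{-i\pi})^\beta}\Big)\,dw . \end{aligned} $$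
   Context: Here $i$ is the imaginary unit. Fractional powers are taken on a single-valued analytic branch with branch cut along the non-positive real axis; the factors $e^{\pm i\pi}$ record the side of the cut (upper side for $+$, lower side for $-$). The process is called the TAR(1) (one-sided tempered stable first order autoregressive) model; its innovation has Laplace transform $\exp\{(\rho s+\lambda)^\beta-(s+\lambda)^\beta\}$, and $g$ is the inverse Laplace transform of this function.
   Formalization: The printed right-hand side has the wrong overall sign (it equals -g); the formal statement puts a minus sign before the sum of the two integrals. The case ρ=0, where λ/ρ is undefined, is excluded. The formula is stated for x>0, with g(x)=0 for x≤0. *)

theory Defs
  imports "HOL-Probability.Probability"
begin

section \<open>Powers on the two sides of the branch cut\<close>

text \<open>
  Boundary values at the real point \<open>x\<close> of the branch of \<open>z\<^sup>\<beta>\<close> that is cut along the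
  non-positive real axis and positive on the positive axis. For \<open>y > 0\<close>, the power
  \<open>(y e\<^bsup>i\<pi>\<^esup>)\<^sup>\<beta>\<close> is \<open>powr_above (- y) \<beta>\<close> and \<open>(y e\<^bsup>-i\<pi>\<^esup>)\<^sup>\<beta>\<close> is \<open>powr_below (- y) \<beta>\<close>.
  The two limit lemmas below justify the closed forms.
\<close>

definition powr_above :: "real \<Rightarrow> real \<Rightarrow> complex" where
  "powr_above x \<beta> =
     (if x < 0 then of_real ((- x) powr \<beta>) * exp (\<i> * of_real (pi * \<beta>)) else of_real (x powr \<beta>))"

definition powr_below :: "real \<Rightarrow> real \<Rightarrow> complex" where
  "powr_below x \<beta> =
     (if x < 0 then of_real ((- x) powr \<beta>) * exp (- \<i> * of_real (pi * \<beta>)) else of_real (x powr \<beta>))"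

lemma powr_above_eq_powr:
  assumes "x \<noteq> 0"
  shows "powr_above x \<beta> = complex_of_real x powr complex_of_real \<beta>"
proof (cases "x < 0")
  case True
  then have "Ln (complex_of_real x) = of_real (ln (- x)) + \<i> * of_real pi"
    using Ln_minus[of "complex_of_real (- x)"] Ln_of_real[of "- x"] by simp
  with True show ?thesis
    by (simp add: powr_above_def powr_def exp_add [symmetric] exp_of_real [symmetric] algebra_simps)
next
  case False
  with assms show ?thesis
    by (simp add: powr_above_def powr_of_real)
qed

lemma powr_below_eq_cnj: "powr_below x \<beta> = cnj (powr_above x \<beta>)"
  by (simp add: powr_above_def powr_below_def exp_cnj)

lemma powr_above_tendsto:
  assumes "x \<noteq> 0"
  shows "((\<lambda>t. Complex x t powr of_real \<beta>) \<longlongrightarrow> powr_above x \<beta>) (at_right 0)"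
proof -
  have C: "((\<lambda>t. Complex x t) \<longlongrightarrow> of_real x) (at_right 0)"
    by (rule tendsto_eq_intros | simp add: complex_of_real_def)+
  have "((\<lambda>t. Ln (Complex x t)) \<longlongrightarrow> Ln (of_real x)) (at_right 0)"
  proof (cases "x < 0")
    case False
    with assms have "isCont Ln (complex_of_real x)"
      by (intro continuous_at_Ln) (simp add: complex_nonpos_Reals_iff)
    then show ?thesis using C by (rule isCont_tendsto_compose)
  next
    case True
    have ev: "\<forall>\<^sub>F t in at_right 0. Ln (Complex x t) = Ln (- Complex x t) + \<i> * of_real pi"
      using eventually_at_right_less[of "0::real"]
    proof eventually_elim
      case (elim t)
      then show ?case
        using Ln_minus[of "- Complex x t"] by (simp add: complex_eq_iff)
    qed
    have "isCont Ln (- complex_of_real x)"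
      using True by (intro continuous_at_Ln) (simp add: complex_nonpos_Reals_iff)
    then have "((\<lambda>t. Ln (- Complex x t) + \<i> * of_real pi) \<longlongrightarrow> Ln (- of_real x) + \<i> * of_real pi) (at_right 0)"
      by (intro tendsto_intros isCont_tendsto_compose[of _ Ln] C) simp
    moreover have "Ln (- of_real x) + \<i> * of_real pi = Ln (complex_of_real x)"
      using Ln_minus[of "complex_of_real (- x)"] True by simp
    ultimately show ?thesis
      using ev by (simp add: tendsto_cong)
  qed
  then have "((\<lambda>t. exp (of_real \<beta> * Ln (Complex x t))) \<longlongrightarrow> exp (of_real \<beta> * Ln (of_real x))) (at_right 0)"
    by (rule tendsto_exp[OF tendsto_mult[OF tendsto_const]])
  moreover have "Complex x t \<noteq> 0" for t
    using assms by (simp add: complex_eq_iff)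
  ultimately show ?thesis
    using assms by (simp add: powr_above_eq_powr powr_def)
qed

lemma powr_below_tendsto:
  assumes "x \<noteq> 0"
  shows "((\<lambda>t. Complex x (- t) powr of_real \<beta>) \<longlongrightarrow> powr_below x \<beta>) (at_right 0)"
proof -
  have "\<forall>\<^sub>F t in at_right 0. cnj (Complex x t powr of_real \<beta>) = Complex x (- t) powr of_real \<beta>"
    using eventually_at_right_less[of "0::real"]
  proof eventually_elim
    case (elim t)
    have "cnj (Complex x t powr of_real \<beta>) = cnj (Complex x t) powr cnj (of_real \<beta>)"
      using elim by (intro cnj_powr) simp
    also have "cnj (Complex x t) = Complex x (- t)"
      by (simp add: complex_eq_iff)
    finally show ?case by simp
  qed
  then show ?thesis
    using tendsto_cnj[OF powr_above_tendsto[OF assms, of \<beta>]]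
    by (simp add: powr_below_eq_cnj tendsto_cong)
qed


section \<open>The TAR(1) process\<close>

context prob_space
begin

definition strictly_stationary :: "(nat \<Rightarrow> 'a \<Rightarrow> real) \<Rightarrow> bool" where
  "strictly_stationary X \<longleftrightarrow>
     (\<forall>n. random_variable borel (X n)) \<and>
     (\<forall>h. distr M (\<Pi>\<^sub>M n\<in>UNIV. borel) (\<lambda>\<omega> n. X (n + h) \<omega>) =
          distr M (\<Pi>\<^sub>M n\<in>UNIV. borel) (\<lambda>\<omega> n. X n \<omega>))"

text \<open>
  The Bochner integral of a non-integrable function is \<open>0\<close>, so the equation below also
  forces \<open>exp (- s Y)\<close> to be integrable.
\<close>

definition positive_tempered_stable :: "real \<Rightarrow> real \<Rightarrow> ('a \<Rightarrow> real) \<Rightarrow> bool" where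
  "positive_tempered_stable lam \<beta> Y \<longleftrightarrow>
     random_variable borel Y \<and> (AE \<omega> in M. 0 < Y \<omega>) \<and>
     (\<forall>s\<ge>0. expectation (\<lambda>\<omega>. exp (- s * Y \<omega>)) = exp (- ((s + lam) powr \<beta> - lam powr \<beta>)))"

definition iid_from_1 :: "(nat \<Rightarrow> 'a \<Rightarrow> real) \<Rightarrow> bool" where
  "iid_from_1 \<epsilon> \<longleftrightarrow>
     indep_vars (\<lambda>_. borel) \<epsilon> {1..} \<and> (\<forall>n\<ge>1. distr M borel (\<epsilon> n) = distr M borel (\<epsilon> 1))"

text \<open>The value \<open>\<epsilon> 0\<close> plays no role: the innovations are \<open>\<epsilon> 1, \<epsilon> 2, \<dots>\<close>.\<close>

definition TAR1 :: "real \<Rightarrow> real \<Rightarrow> real \<Rightarrow> (nat \<Rightarrow> 'a \<Rightarrow> real) \<Rightarrow> (nat \<Rightarrow> 'a \<Rightarrow> real) \<Rightarrow> bool" where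
  "TAR1 lam \<beta> \<rho> X \<epsilon> \<longleftrightarrow>
     strictly_stationary X \<and>
     iid_from_1 \<epsilon> \<and>
     (\<forall>n\<ge>1. AE \<omega> in M. X n \<omega> = \<rho> * X (n - 1) \<omega> + \<epsilon> n \<omega>) \<and>
     (\<forall>n\<ge>1. \<forall>j<n. indep_var borel (\<epsilon> n) borel (X j)) \<and>
     (\<forall>n. positive_tempered_stable lam \<beta> (X n))"

end


section \<open>The integrands\<close>

text \<open>
  With \<open>s = - lam / \<rho> - w\<close> (first integral) and \<open>s = - lam - w\<close> (second integral), each function
  is the jump, upper minus lower boundary value, of
  \<open>e\<^bsup>sx\<^esup> exp ((\<rho> s + lam)\<^sup>\<beta> - (s + lam)\<^sup>\<beta>)\<close> across the cut
  (for \<open>0 < \<rho> < 1\<close>). Folding the upward Bromwich line onto the cut runs inwards along the lower side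
  and outwards along the upper side, with \<open>ds = - dw\<close>; hence the density is minus
  \<open>1 / (2\<pi>i)\<close> times the integral of these jumps.
\<close>

definition TAR1_integrand1 :: "real \<Rightarrow> real \<Rightarrow> real \<Rightarrow> real \<Rightarrow> real \<Rightarrow> complex" where
  "TAR1_integrand1 lam \<beta> \<rho> x w =
     of_real (exp (- lam * x / \<rho>)) * of_real (exp (- w * x)) *
       exp ((of_real \<rho> powr of_real \<beta>) * of_real (w powr \<beta>) * exp (\<i> * of_real (pi * \<beta>))
            - powr_above (- w + lam - lam / \<rho>) \<beta>)
     - of_real (exp (- lam * x / \<rho>)) * of_real (exp (- w * x)) *
       exp ((of_real \<rho> powr of_real \<beta>) * of_real (w powr \<beta>) * exp (- \<i> * of_real (pi * \<beta>))
            - powr_below (- w + lam - lam / \<rho>) \<beta>)"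

definition TAR1_integrand2 :: "real \<Rightarrow> real \<Rightarrow> real \<Rightarrow> real \<Rightarrow> real \<Rightarrow> complex" where
  "TAR1_integrand2 lam \<beta> \<rho> x w =
     of_real (exp (- lam * x)) * of_real (exp (- w * x)) *
       exp (powr_above (- lam * \<rho> - \<rho> * w + lam) \<beta> - powr_above (- w) \<beta>)
     - of_real (exp (- lam * x)) * of_real (exp (- w * x)) *
       exp (powr_below (- lam * \<rho> - \<rho> * w + lam) \<beta> - powr_below (- w) \<beta>)"

end

theory Submission
  imports Defs "HOL-Complex_Analysis.Complex_Analysis" "HOL-Real_Asymp.Real_Asymp"
begin

text \<open>
  Taking Laplace transforms in \<open>X\<^sub>1 = \<rho> X\<^sub>0 + \<epsilon>\<^sub>1\<close> and using independence, the innovation must have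
  the transform \<open>F(s) = exp ((\<rho> s + lam)\<^sup>\<beta> - (s + lam)\<^sup>\<beta>)\<close>. The density comes from Fourier inversion
  of \<open>F\<close> on the imaginary axis, followed by turning the line of integration onto the cut.

  The sign of \<open>\<rho>\<close>. For \<open>\<rho> < 0\<close> the process does not exist: the transform identity at \<open>s \<ge> 0\<close> would
  make every exponential moment of the tempered stable \<open>X\<^sub>0\<close> finite, so that its transform would be
  differentiable at \<open>- lam\<close>, where \<open>exp (lam\<^sup>\<beta> - (s + lam)\<^sup>\<beta>)\<close> has a vertical tangent
  (\<open>ar_coefficient_nonneg\<close>). So \<open>0 < \<rho> < 1\<close>, and then \<open>lam < lam / \<rho>\<close>.

  Fourier inversion. The transform of \<open>X\<^sub>n\<close> is known on the positive axis; it extends by analytic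
  continuation to the right half plane and by continuity to its boundary, which determines the
  characteristic function of \<open>X\<^sub>n\<close> and, by division, that of \<open>\<epsilon>\<^sub>1\<close> (\<open>char_innovation\<close>). It decays like
  \<open>exp (- c \<bar>t\<bar>\<^sup>\<beta>)\<close>, hence is integrable, and an integrable characteristic function has the
  continuous density \<open>1 / (2\<pi>) \<integral> e\<^bsup>-itx\<^esup> \<phi>(t) dt\<close> (\<open>density_inversion\<close>). Since \<open>F \<le> 1\<close> on the
  positive axis, \<open>\<epsilon>\<^sub>1\<close> is almost surely nonnegative, so this density vanishes on the left half line.

  Turning the contour. With the branch used here, \<open>F\<close> is continuous on the \<^emph>\<open>closed\<close> upper half plane,
  where it takes the values of the upper side of the cut, and holomorphic in its interior. Cauchy's
  theorem for triangles with vertices \<open>0\<close>, \<open>iR\<close>, \<open>- R\<close> therefore moves \<open>\<integral> e\<^bsup>sx\<^esup> F(s) ds\<close> from the positive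
  imaginary to the negative real axis (\<open>quadrant_rotation\<close>), given a bound that makes the
  third side negligible (\<open>innovation_laplace_decay\<close>). The lower half of the Bromwich line is the complex
  conjugate of the upper half, so only the imaginary part along the negative axis survives. It is zero
  up to \<open>- lam\<close>; the stretch from \<open>- lam\<close> to \<open>- lam / \<rho>\<close> is the second integral of the formula, and the
  rest the first (\<open>cut_integral_split\<close>).
\<close>

section \<open>Powers on the closed upper half plane\<close>

text \<open>
  Rotating the upper half plane onto the right half plane moves the branch cut away from its
  boundary; this is what gives access to the values on the upper side of the cut.
\<close>

lemma powr_upper_half_plane:
  fixes w :: complex
  assumes "0 \<le> Im w" "w \<noteq> 0"
  shows "w powr of_real \<beta> = exp (\<i> * of_real (pi * \<beta> / 2)) * (- \<i> * w) powr of_real \<beta>"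
proof -
  have "Ln (\<i> * (- \<i> * w)) = Ln (- \<i> * w) + \<i> * of_real pi / 2"
    using assms by (subst Ln_times_ii) auto
  then have "Ln w = Ln (- \<i> * w) + \<i> * of_real pi / 2" by simp
  then show ?thesis
    using assms by (simp add: powr_def exp_add [symmetric] algebra_simps)
qed

text \<open>
  The principal value on the negative axis has argument \<open>\<pi>\<close>, so it is the limit from above, and the power
  is continuous up to the cut when it is approached from the upper half plane only.
\<close>

lemma continuous_on_powr_upper_half_plane:
  assumes "0 < \<beta>"
  shows "continuous_on {w. 0 \<le> Im w} (\<lambda>w. w powr complex_of_real \<beta>)"
  unfolding continuous_on_def
proof (intro ballI)
  fix w :: complex assume w: "w \<in> {w. 0 \<le> Im w}"
  show "((\<lambda>w. w powr of_real \<beta>) \<longlongrightarrow> w powr of_real \<beta>) (at w within {w. 0 \<le> Im w})"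
  proof (cases "w = 0")
    case True
    have "((\<lambda>z. norm z powr \<beta>) \<longlongrightarrow> norm (0::complex) powr \<beta>) (at w within {w. 0 \<le> Im w})"
      using assms True by (intro tendsto_powr' tendsto_norm tendsto_const) (auto intro: tendsto_eq_intros)
    then have "((\<lambda>z. norm (z powr of_real \<beta>)) \<longlongrightarrow> 0) (at w within {w. 0 \<le> Im w})"
      using assms by (simp add: norm_powr_real_powr')
    then show ?thesis using True tendsto_norm_zero_iff by fastforce
  next
    case False
    have nn: "- \<i> * w \<notin> \<real>\<^sub>\<le>\<^sub>0"
      using w False by (auto simp: complex_nonpos_Reals_iff complex_eq_iff)
    have "((\<lambda>z. exp (\<i> * of_real (pi * \<beta> / 2)) * (- \<i> * z) powr of_real \<beta>) \<longlongrightarrow>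
        exp (\<i> * of_real (pi * \<beta> / 2)) * (- \<i> * w) powr of_real \<beta>) (at w within {w. 0 \<le> Im w})"
      using nn by (intro tendsto_intros tendsto_powr_complex) auto
    moreover have "\<forall>\<^sub>F z in at w within {w. 0 \<le> Im w}.
       exp (\<i> * of_real (pi * \<beta> / 2)) * (- \<i> * z) powr of_real \<beta> = z powr of_real \<beta>"
    proof -
      have "\<forall>\<^sub>F z in at w within {w. 0 \<le> Im w}. z \<noteq> 0"
        using False by (intro tendsto_imp_eventually_ne[of "\<lambda>x. x"]) auto
      moreover have "\<forall>\<^sub>F z in at w within {w. 0 \<le> Im w}. z \<in> {w. 0 \<le> Im w}"
        by (auto simp: eventually_at_filter)
      ultimately show ?thesis
        by eventually_elim (metis mem_Collect_eq powr_upper_half_plane)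
    qed
    ultimately have "((\<lambda>z. z powr of_real \<beta>) \<longlongrightarrow>
        exp (\<i> * of_real (pi * \<beta> / 2)) * (- \<i> * w) powr of_real \<beta>) (at w within {w. 0 \<le> Im w})"
      by (rule Lim_transform_eventually)
    moreover have "w powr of_real \<beta> = exp (\<i> * of_real (pi * \<beta> / 2)) * (- \<i> * w) powr of_real \<beta>"
      using w False by (intro powr_upper_half_plane) auto
    ultimately show ?thesis by metis
  qed
qed

text \<open>
  The derivative \<open>\<beta> w\<^bsup>\<beta> - 1\<^esup>\<close> is at most 1 in modulus outside the unit disc. The segment from \<open>w\<close> to
  \<open>w + \<mu>\<close> may run along the cut, so the mean value bound is applied after the rotation.
\<close>

lemma powr_shift_bounded:
  fixes w :: complex
  assumes "0 < \<beta>" "\<beta> < 1" "0 \<le> Im w" "0 \<le> \<mu>" "\<mu> + 1 \<le> norm w"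
  shows "norm ((w + of_real \<mu>) powr of_real \<beta> - w powr of_real \<beta>) \<le> \<mu>"
proof -
  define u where "u = - \<i> * w"
  define v where "v = - \<i> * (w + of_real \<mu>)"
  have dist: "norm (v - u) = \<mu>" using assms by (simp add: u_def v_def norm_mult algebra_simps)
  have seg: "0 \<le> Re z \<and> 1 \<le> norm z" if z: "z \<in> closed_segment u v" for z
  proof -
    have "norm (z - u) \<le> \<mu>" using segment_bound(1)[OF z] dist by simp
    moreover have "norm u \<le> norm z + norm (z - u)" by (metis norm_triangle_sub norm_minus_commute)
    moreover have "norm u = norm w" by (simp add: u_def norm_mult)
    moreover have "0 \<le> Re z"
    proof -
      obtain t where "z = (1 - t) *\<^sub>R u + t *\<^sub>R v" using z unfolding in_segment by blast
      then have "Re z = (1 - t) * Im w + t * Im w" by (simp add: u_def v_def)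
      also have "\<dots> = Im w" by (simp add: algebra_simps)
      finally show ?thesis using assms by simp
    qed
    ultimately show ?thesis using assms by linarith
  qed
  have nn: "z \<notin> \<real>\<^sub>\<le>\<^sub>0" if "z \<in> closed_segment u v" for z
    using seg[OF that] by (auto simp: complex_nonpos_Reals_iff complex_eq_iff norm_complex_def)
  have "norm (v powr of_real \<beta> - u powr of_real \<beta>) \<le> 1 * norm (v - u)"
  proof (rule field_differentiable_bound[of "closed_segment u v" _ "\<lambda>z. of_real \<beta> * z powr (of_real \<beta> - 1)"])
    fix z assume z: "z \<in> closed_segment u v"
    show "((\<lambda>z. z powr of_real \<beta>) has_field_derivative of_real \<beta> * z powr (of_real \<beta> - 1)) (at z within closed_segment u v)"
      using nn[OF z] by (rule has_field_derivative_powr[THEN DERIV_subset]) simp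
    have "norm (z powr (of_real \<beta> - 1)) = norm z powr (\<beta> - 1)"
      using norm_powr_real_powr'[of "of_real (\<beta> - 1)" z] by simp
    also have "\<dots> \<le> 1" using seg[OF z] assms powr_mono[of "\<beta> - 1" 0 "norm z"] by (auto split: if_splits)
    finally show "norm (of_real \<beta> * z powr (of_real \<beta> - 1)) \<le> 1"
      using assms by (simp add: norm_mult mult_le_one)
  qed auto
  moreover have "w \<noteq> 0" "w + of_real \<mu> \<noteq> 0"
    using assms seg[of v] by (auto simp: v_def norm_mult)
  ultimately show ?thesis
    using assms dist powr_upper_half_plane[of w \<beta>] powr_upper_half_plane[of "w + of_real \<mu>" \<beta>]
    by (simp add: u_def v_def right_diff_distrib[symmetric] norm_mult)
qed

text \<open>
  The real part \<open>\<bar>w\<bar>\<^sup>\<beta> cos (\<beta> arg w)\<close> is at least \<open>\<bar>w\<bar>\<^sup>\<beta> cos (\<pi>\<beta>/2)\<close> in the first quadrant. In the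
  second quadrant it may become negative, but the loss is at most linear in \<open>sin (arg w - \<pi>/2)\<close>, that is, in
  \<open>- Re w / \<bar>w\<bar>\<close>. For large \<open>\<bar>w\<bar>\<close> that loss is absorbed by the factor \<open>e\<^bsup>x Re w\<^esup>\<close> of the integrand.
\<close>

lemma Re_powr_upper_half_plane_ge:
  fixes w :: complex
  assumes "0 < \<beta>" "\<beta> < 1" "0 \<le> Im w" "w \<noteq> 0"
  shows "Re (w powr of_real \<beta>) \<ge>
    cos (pi * \<beta> / 2) * norm w powr \<beta> - 2 * norm w powr (\<beta> - 1) * max 0 (- Re w)"
proof -
  \<comment> \<open>\<open>y\<close> is the argument of \<open>w\<close>, measured from the imaginary axis\<close>
  define y where "y = Im (Ln (- \<i> * w))"
  have r: "norm (- \<i> * w) = norm w" by (simp add: norm_mult)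
  have nz: "- \<i> * w \<noteq> 0" using assms by simp
  have y: "\<bar>y\<bar> \<le> pi / 2" using Re_Ln_pos_le[OF nz] assms by (simp add: y_def)
  have siny: "norm w * sin y = - Re w"
  proof -
    have "Im (exp (Ln (- \<i> * w))) = norm w * sin y"
      using nz r assms unfolding Im_exp y_def by simp
    then show ?thesis using nz by simp
  qed
  define A where "A = pi * \<beta> / 2"
  have A: "0 \<le> A" "A < pi / 2" using assms by (auto simp: A_def)
  have By: "\<bar>\<beta> * y\<bar> \<le> A"
    using y assms mult_left_mono[of "\<bar>y\<bar>" "pi / 2" \<beta>] by (simp add: abs_mult A_def mult.commute)
  have "w powr of_real \<beta> = exp (\<i> * of_real A + of_real \<beta> * Ln (- \<i> * w))"
    using powr_upper_half_plane[of w \<beta>] assms by (simp add: powr_def exp_add A_def)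
  then have "Re (w powr of_real \<beta>) = exp (\<beta> * ln (norm w)) * cos (A + \<beta> * y)"
    using nz r by (simp add: Re_exp y_def)
  also have "exp (\<beta> * ln (norm w)) = norm w powr \<beta>"
    using assms by (simp add: powr_def)
  finally have Re_eq: "Re (w powr of_real \<beta>) = norm w powr \<beta> * cos (A + \<beta> * y)" .
  show ?thesis
  proof (cases "y \<le> 0")
    case True
    then have "cos A \<le> cos (A + \<beta> * y)"
      using A By assms by (intro cos_monotone_0_pi_le) (auto simp: mult_nonneg_nonpos)
    then have "cos A * norm w powr \<beta> \<le> Re (w powr of_real \<beta>)"
      unfolding Re_eq by (subst mult.commute) (intro mult_left_mono, auto)
    then show ?thesis
      unfolding A_def by (smt (verit) mult_nonneg_nonneg powr_ge_zero)
  next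
    case False
    then have y0: "0 < y" "y \<le> pi / 2" using y by auto
    have bnd: "0 \<le> \<beta> * y" "\<beta> * y \<le> y" using y0 assms by (auto simp: mult_left_le_one_le)
    have s: "0 \<le> sin y" "0 \<le> cos y" using y0 by (auto intro!: sin_ge_zero cos_ge_zero)
    have "1 \<le> (cos y + sin y)\<^sup>2"
      using s by (simp add: power2_sum)
    then have "1 \<le> cos y + sin y" using s power2_le_imp_le[of 1 "cos y + sin y"] by simp
    moreover have "cos y \<le> cos (\<beta> * y)" using bnd y0 pi_gt_zero by (intro cos_monotone_0_pi_le; linarith)
    moreover have "sin (\<beta> * y) \<le> sin y" using bnd y0 pi_gt_zero by (intro sin_monotone_2pi_le; linarith)
    moreover have "0 \<le> sin (\<beta> * y)" using bnd y0 pi_gt_zero by (intro sin_ge_zero; linarith)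
    moreover have "0 \<le> cos A" using A by (intro cos_ge_zero) auto
    moreover have "sin A * sin (\<beta> * y) \<le> sin (\<beta> * y)"
      using calculation A by (intro mult_left_le_one_le) (auto intro!: sin_ge_zero)
    moreover have "cos A * (1 - sin y) \<le> cos A * cos (\<beta> * y)"
      using calculation by (intro mult_left_mono) auto
    moreover have "cos A * sin y \<le> sin y"
      using s calculation by (intro mult_left_le_one_le) auto
    ultimately have "cos A - 2 * sin y \<le> cos (A + \<beta> * y)"
      by (simp add: cos_add algebra_simps)
    then have "norm w powr \<beta> * (cos A - 2 * sin y) \<le> Re (w powr of_real \<beta>)"
      unfolding Re_eq by (intro mult_left_mono) auto
    moreover have "norm w powr \<beta> * sin y = norm w powr (\<beta> - 1) * (- Re w)"
      unfolding siny[symmetric] using assms by (simp add: powr_diff)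
    moreover have "max 0 (- Re w) = - Re w" using siny s by (metis max_absorb2 mult_nonneg_nonneg norm_ge_zero)
    ultimately show ?thesis by (simp add: A_def algebra_simps)
  qed
qed

lemma powr_of_real_mult:
  assumes "0 < r"
  shows "(of_real r * z) powr of_real \<beta> = of_real (r powr \<beta>) * z powr complex_of_real \<beta>"
proof (cases "z = 0")
  case False
  then have "(of_real r * z) powr of_real \<beta> = exp (of_real (\<beta> * ln r) + of_real \<beta> * Ln z)"
    using assms Ln_times_of_real[of r z] by (simp add: powr_def distrib_left Ln_of_real)
  also have "\<dots> = of_real (exp (\<beta> * ln r)) * exp (of_real \<beta> * Ln z)"
    by (simp only: exp_add exp_of_real)
  finally show ?thesis using assms False by (simp add: powr_def)
qed simp

section \<open>The transform of the innovation and its decay\<close>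

text \<open>
  The transform of the innovation on the closed upper half plane; on the negative real axis its principal
  powers give the boundary values on the upper side of the cut.
\<close>

definition innovation_laplace :: "real \<Rightarrow> real \<Rightarrow> real \<Rightarrow> complex \<Rightarrow> complex" where
  "innovation_laplace lam \<beta> \<rho> s =
     exp ((of_real \<rho> * s + of_real lam) powr of_real \<beta> - (s + of_real lam) powr of_real \<beta>)"

lemma continuous_on_innovation_laplace:
  assumes "0 < \<beta>" "0 < \<rho>"
  shows "continuous_on {s. 0 \<le> Im s} (innovation_laplace lam \<beta> \<rho>)"
  unfolding innovation_laplace_def
  by (intro continuous_intros continuous_on_compose2[OF continuous_on_powr_upper_half_plane])
    (use assms in auto)

lemma innovation_laplace_differentiable:
  assumes "0 < \<rho>" "0 < Im s"
  shows "innovation_laplace lam \<beta> \<rho> field_differentiable at s"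
proof -
  have "innovation_laplace lam \<beta> \<rho> holomorphic_on {s. 0 < Im s}"
    unfolding innovation_laplace_def
    using assms by (intro holomorphic_intros) (auto simp: complex_nonpos_Reals_iff)
  then show ?thesis
    using assms by (auto simp: open_halfspace_Im_gt intro: holomorphic_on_imp_differentiable_at)
qed

text \<open>
  With \<open>w = s + lam\<close> and \<open>\<mu> = lam/\<rho> - lam\<close> one has \<open>\<rho> s + lam = \<rho> (w + \<mu>)\<close>. Up to the bounded error of
  shifting by \<open>\<mu>\<close>, the exponent of \<open>F\<close> is therefore \<open>- (1 - \<rho>\<^sup>\<beta>) w\<^sup>\<beta>\<close>. Its real part makes \<open>F\<close> decay like
  \<open>exp (- k \<bar>w\<bar>\<^sup>\<beta>)\<close> near the imaginary axis. For \<open>\<beta> > 1/2\<close> the function \<open>F\<close> grows near the negative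
  axis, but only like \<open>exp (C \<bar>w\<bar>\<^sup>\<beta>)\<close>, and there \<open>e\<^bsup>sx\<^esup>\<close> wins. The quadratic rate is a convenient
  consequence: it is integrable, and beats the length of the third side of the triangle.
\<close>

lemma innovation_laplace_decay:
  assumes "0 < lam" "0 < \<beta>" "\<beta> < 1" "0 < \<rho>" "\<rho> < 1" "0 < x"
  obtains B where "0 \<le> B" "\<And>s. Re s \<le> 0 \<Longrightarrow> 0 \<le> Im s \<Longrightarrow>
      norm (exp (s * of_real x) * innovation_laplace lam \<beta> \<rho> s) \<le> B / (1 + (norm s)\<^sup>2)"
proof -
  define H where "H s = exp (s * of_real x) * innovation_laplace lam \<beta> \<rho> s" for s
  define \<mu> where "\<mu> = lam / \<rho> - lam"
  have \<mu>: "0 \<le> \<mu>" "\<rho> * (lam + \<mu>) = lam"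
    using assms by (auto simp: \<mu>_def divide_simps)
  define c where "c = 1 - \<rho> powr \<beta>"
  have c: "0 < c" "\<rho> powr \<beta> \<le> 1" using assms powr_less_mono2[of \<beta> \<rho> 1] by (auto simp: c_def)
  define m where "m = cos (pi * \<beta> / 2)"
  have m: "0 < m" using assms mult_strict_left_mono[of \<beta> 1 pi] unfolding m_def by (intro cos_gt_zero) auto
  define k where "k = c * m"
  have k: "0 < k" using c m by (simp add: k_def)
  \<comment> \<open>The estimate far from the origin; the remaining part of the quadrant is compact.\<close>
  have far: "norm (H s) \<le> exp (\<mu> - k * norm w powr \<beta>)"
    if s: "Re s \<le> 0" "0 \<le> Im s" and w_def: "w = s + of_real lam"
      and big: "\<mu> + 1 \<le> norm w" "2 * c * norm w powr (\<beta> - 1) \<le> x" for s w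
  proof -
    \<comment> \<open>\<open>q\<close> measures how far \<open>w\<close> is into the second quadrant\<close>
    define q where "q = max 0 (- Re w)"
    define P where "P = Re (w powr of_real \<beta>)"
    define P' where "P' = Re ((w + of_real \<mu>) powr of_real \<beta>)"
    have w: "0 \<le> Im w" "w \<noteq> 0" using s big \<mu> by (auto simp: w_def)
    have "(of_real \<rho> * (w + of_real \<mu>)) powr of_real \<beta> = of_real (\<rho> powr \<beta>) * (w + of_real \<mu>) powr of_real \<beta>"
      using assms by (intro powr_of_real_mult)
    moreover have "of_real \<rho> * s + of_real lam = of_real \<rho> * (w + of_real \<mu>)"
      using \<mu>(2) unfolding w_def by (metis add.assoc distrib_left of_real_add of_real_mult)
    ultimately have "norm (H s) = exp (x * Re s + (\<rho> powr \<beta> * P' - P))"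
      by (simp add: H_def innovation_laplace_def norm_mult w_def P_def P'_def exp_add[symmetric] mult.commute)
    also have "x * Re s + (\<rho> powr \<beta> * P' - P) \<le> \<mu> - k * norm w powr \<beta>"
    proof -
      have "P' - P \<le> \<mu>"
        using powr_shift_bounded[of \<beta> w \<mu>] assms w \<mu> big abs_Re_le_cmod[of "(w + of_real \<mu>) powr of_real \<beta> - w powr of_real \<beta>"]
        by (simp add: P_def P'_def)
      then have "\<rho> powr \<beta> * (P' - P) \<le> \<rho> powr \<beta> * \<mu>" by (intro mult_left_mono) auto
      also have "\<dots> \<le> \<mu>" using c \<mu> by (intro mult_left_le_one_le) auto
      finally have "\<rho> powr \<beta> * P' - P \<le> \<mu> - c * P" by (simp add: c_def algebra_simps)
      moreover have "c * (m * norm w powr \<beta> - 2 * norm w powr (\<beta> - 1) * q) \<le> c * P"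
        using Re_powr_upper_half_plane_ge[of \<beta> w] assms w c
        by (intro mult_left_mono) (auto simp: P_def m_def q_def)
      moreover have "2 * c * norm w powr (\<beta> - 1) * q \<le> x * q"
        using big by (intro mult_right_mono) (auto simp: q_def)
      moreover have "x * Re s \<le> x * (- q)"
        using s assms by (intro mult_left_mono) (auto simp: q_def w_def)
      ultimately show ?thesis by (simp add: k_def algebra_simps)
    qed
    finally show ?thesis by simp
  qed
  have "\<forall>\<^sub>F r in at_top. exp (\<mu> - k * r powr \<beta>) * (1 + (r + lam)\<^sup>2) < 1"
  proof (rule order_tendstoD(2))
    show "((\<lambda>r. exp (\<mu> - k * r powr \<beta>) * (1 + (r + lam)\<^sup>2)) \<longlongrightarrow> 0) at_top"
      using k assms by real_asymp
  qed simp
  moreover have "\<forall>\<^sub>F r in at_top. 2 * c * r powr (\<beta> - 1) < x"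
  proof (rule order_tendstoD(2))
    show "((\<lambda>r. 2 * c * r powr (\<beta> - 1)) \<longlongrightarrow> 0) at_top"
      using c assms by real_asymp
  qed (use assms in auto)
  moreover have "\<forall>\<^sub>F r in at_top. \<mu> + 1 \<le> r" by (rule eventually_ge_at_top)
  ultimately have "\<forall>\<^sub>F r in at_top. \<mu> + 1 \<le> r \<and> 2 * c * r powr (\<beta> - 1) < x \<and>
      exp (\<mu> - k * r powr \<beta>) * (1 + (r + lam)\<^sup>2) < 1"
    by eventually_elim auto
  then obtain R where R: "\<And>r. R \<le> r \<Longrightarrow> \<mu> + 1 \<le> r \<and> 2 * c * r powr (\<beta> - 1) < x \<and>
      exp (\<mu> - k * r powr \<beta>) * (1 + (r + lam)\<^sup>2) < 1"
    unfolding eventually_at_top_linorder by auto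
  define K where "K = {s. Re s \<le> 0} \<inter> {s. 0 \<le> Im s} \<inter> cball (- of_real lam) R"
  have "compact K"
    unfolding K_def by (intro closed_Int_compact closed_Int closed_halfspace_Re_le closed_halfspace_Im_ge compact_cball)
  moreover have "continuous_on K (\<lambda>s. H s * of_real (1 + (norm s)\<^sup>2))"
    unfolding H_def
    by (intro continuous_intros continuous_on_subset[OF continuous_on_innovation_laplace])
      (use assms in \<open>auto simp: K_def\<close>)
  ultimately have "bounded ((\<lambda>s. H s * of_real (1 + (norm s)\<^sup>2)) ` K)"
    by (intro compact_imp_bounded compact_continuous_image)
  then obtain B where B: "\<And>s. s \<in> K \<Longrightarrow> norm (H s * of_real (1 + (norm s)\<^sup>2)) \<le> B"
    unfolding bounded_iff by auto
  show ?thesis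
  proof (rule that[of "max B 1"])
    fix s assume s: "Re s \<le> 0" "0 \<le> Im s"
    have pos: "0 < 1 + (norm s)\<^sup>2" by (simp add: add_pos_nonneg)
    have "norm (H s) * (1 + (norm s)\<^sup>2) \<le> max B 1"
    proof (cases "norm (s + of_real lam) \<le> R")
      case True
      then have "s \<in> K" using s by (simp add: K_def dist_norm norm_minus_commute add.commute)
      from B[OF this] have "norm (H s) * (1 + (norm s)\<^sup>2) \<le> B"
        by (simp only: norm_mult norm_of_real abs_of_pos[OF pos])
      then show ?thesis by simp
    next
      case False
      define r where "r = norm (s + of_real lam)"
      have r: "R \<le> r" using False by (simp add: r_def)
      have "norm s \<le> r + lam"
        using norm_triangle_ineq4[of "s + of_real lam" "of_real lam"] assms by (simp add: r_def)
      then have "(norm s)\<^sup>2 \<le> (r + lam)\<^sup>2" by (intro power_mono) auto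
      moreover have "norm (H s) \<le> exp (\<mu> - k * r powr \<beta>)"
        unfolding r_def by (rule far) (use s R[OF r] in \<open>auto simp: r_def\<close>)
      ultimately have "norm (H s) * (1 + (norm s)\<^sup>2) \<le> exp (\<mu> - k * r powr \<beta>) * (1 + (r + lam)\<^sup>2)"
        by (intro mult_mono) auto
      then show ?thesis using R[OF r] by linarith
    qed
    then show "norm (exp (s * of_real x) * innovation_laplace lam \<beta> \<rho> s) \<le> max B 1 / (1 + (norm s)\<^sup>2)"
      using pos by (simp add: H_def pos_le_divide_eq)
  qed simp
qed

section \<open>Turning the imaginary axis onto the negative real axis\<close>

lemma contour_integral_linepath_ray:
  fixes H :: "complex \<Rightarrow> complex" and d :: complex
  assumes "0 < R" "continuous_on (closed_segment 0 (of_real R * d)) H"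
  shows "contour_integral (linepath 0 (of_real R * d)) H = d * (LINT t:{0..R}|lborel. H (of_real t * d))"
proof -
  have mem: "of_real t * d \<in> closed_segment 0 (of_real R * d)" if "t \<in> {0..R}" for t
    using that assms unfolding in_segment
    by (intro exI[of _ "t / R"]) (auto simp: scaleR_conv_of_real)
  have "continuous_on {0..R} (\<lambda>t. H (of_real t * d))"
    by (rule continuous_on_compose2[OF assms(2)]) (use mem in \<open>auto intro!: continuous_intros\<close>)
  then have i: "set_integrable lborel {0..R} (\<lambda>t. H (of_real t * d))"
    by (rule borel_integrable_atLeastAtMost')
  have "((\<lambda>t. H (of_real t * d)) has_integral (LINT t:{0..R}|lborel. H (of_real t * d))) {Re 0..Re (of_real R)}"
    using set_borel_integral_eq_integral[OF i] by (simp add: integrable_integral)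
  then have "((\<lambda>z. H (z * d)) has_contour_integral (LINT t:{0..R}|lborel. H (of_real t * d))) (linepath 0 (of_real R))"
    by (subst has_contour_integral_linepath_Reals_iff) (use assms in auto)
  then have "((\<lambda>u. d * (H (linepath 0 (of_real R) u * d) * (of_real R - 0))) has_integral
     d * (LINT t:{0..R}|lborel. H (of_real t * d))) {0..1}"
    unfolding has_contour_integral_linepath by (rule has_integral_mult_right)
  then have "(H has_contour_integral d * (LINT t:{0..R}|lborel. H (of_real t * d))) (linepath 0 (of_real R * d))"
    unfolding has_contour_integral_linepath by (simp add: linepath_def algebra_simps scaleR_conv_of_real)
  then show ?thesis by (rule contour_integral_unique)
qed

text \<open>
  Cauchy's theorem for the triangle with vertices \<open>0\<close>, \<open>iR\<close>, \<open>- R\<close>. The hypotenuse stays at distance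
  at least \<open>R / \<surd>2\<close> from \<open>0\<close> and has length at most \<open>2 R\<close>, so its contribution is \<open>O(1/R)\<close>. The
  function need only be continuous on the boundary, which is why singularities on the negative axis do
  no harm.
\<close>

lemma quadrant_rotation:
  fixes H :: "complex \<Rightarrow> complex"
  defines "Q \<equiv> {s. Re s \<le> 0} \<inter> {s. 0 \<le> Im s}"
  assumes cont: "continuous_on Q H"
    and diff: "\<And>s. s \<in> interior Q \<Longrightarrow> H field_differentiable at s"
    and "0 \<le> B" and bound: "\<And>s. s \<in> Q \<Longrightarrow> norm (H s) \<le> B / (1 + (norm s)\<^sup>2)"
  shows "set_integrable lborel {0<..} (\<lambda>t. H (of_real t * \<i>))"
    and "set_integrable lborel {0<..} (\<lambda>v. H (- of_real v))"
    and "\<i> * (LINT t:{0<..}|lborel. H (of_real t * \<i>)) = - (LINT v:{0<..}|lborel. H (- of_real v))"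
proof -
  have ray: "set_integrable lborel {0..} (\<lambda>t. H (of_real t * d))"
    if "norm d = 1" and d: "\<And>t. 0 \<le> t \<Longrightarrow> of_real t * d \<in> Q" for d
  proof (rule set_integrable_bound)
    have "set_integrable lborel {0<..} (\<lambda>t::real. B * (1 / (1 + t\<^sup>2)))"
      using integrable_I0i_1_div_plus_square
      by (intro set_integrable_mult_right) (simp add: interval_lebesgue_integrable_def zero_ereal_def)
    then show "set_integrable lborel {0..} (\<lambda>t::real. B * (1 / (1 + t\<^sup>2)))"
      by (subst set_integrable_discrete_difference[where X="{0}" and B="{0<..}"]) auto
    have "continuous_on {0..} (\<lambda>t. H (of_real t * d))"
      by (rule continuous_on_compose2[OF cont]) (use d in \<open>auto intro!: continuous_intros\<close>)
    then show "set_borel_measurable lborel {0..} (\<lambda>t. H (of_real t * d))"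
      unfolding set_borel_measurable_def by (simp add: borel_measurable_continuous_on_indicator)
    show "AE t in lborel. t \<in> {0..} \<longrightarrow> norm (H (of_real t * d)) \<le> norm (B * (1 / (1 + t\<^sup>2)))"
      using bound[OF d] that(1) \<open>0 \<le> B\<close> by (intro AE_I2) (auto simp: norm_mult abs_mult)
  qed
  have open_closed: "set_integrable lborel {0<..} f" "(LINT t:{0<..}|lborel. f t) = (LINT t:{0..}|lborel. f t)"
    if "set_integrable lborel {0..} f" for f :: "real \<Rightarrow> complex"
  proof -
    show "set_integrable lborel {0<..} f" by (rule set_integrable_subset[OF that]) auto
    show "(LINT t:{0<..}|lborel. f t) = (LINT t:{0..}|lborel. f t)"
      by (rule set_integral_discrete_difference[where X="{0}"]) auto
  qed
  have i1: "set_integrable lborel {0..} (\<lambda>t. H (of_real t * \<i>))" by (rule ray) (auto simp: Q_def)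
  have i2: "set_integrable lborel {0..} (\<lambda>t. H (of_real t * - 1))" by (rule ray) (auto simp: Q_def)
  have convex: "convex Q" unfolding Q_def by (intro convex_Int convex_halfspace_Re_le convex_halfspace_Im_ge)
  have triangle: "\<i> * (LINT t:{0..R}|lborel. H (of_real t * \<i>)) + contour_integral (linepath (of_real R * \<i>) (of_real R * - 1)) H
      = - 1 * (LINT t:{0..R}|lborel. H (of_real t * - 1))" if R: "0 < R" for R
  proof -
    let ?a = "complex_of_real R * \<i>" and ?b = "complex_of_real R * - 1"
    have in_Q: "0 \<in> Q" "?a \<in> Q" "?b \<in> Q" using R by (auto simp: Q_def)
    have seg: "closed_segment p q \<subseteq> Q" if "p \<in> Q" "q \<in> Q" for p q
      using convex that by (rule closed_segment_subset[rotated 2])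
    have c: "continuous_on (closed_segment p q) H" if "p \<in> Q" "q \<in> Q" for p q
      using continuous_on_subset[OF cont seg[OF that]] .
    have "(H has_contour_integral 0) (linepath 0 ?a +++ linepath ?a ?b +++ linepath ?b 0)"
      using seg in_Q by (intro Cauchy_theorem_convex[OF cont convex, of "{}"] diff)
        (auto simp: path_image_join)
    then have "contour_integral (linepath 0 ?a) H + contour_integral (linepath ?a ?b) H + contour_integral (linepath ?b 0) H = 0"
      by (rule has_chain_integral_chain_integral3)
    moreover have "contour_integral (linepath ?b 0) H = - contour_integral (linepath 0 ?b) H"
      using c in_Q by (intro contour_integral_reverse_linepath)
    ultimately show ?thesis
      using contour_integral_linepath_ray[OF R c[of 0 ?a]] contour_integral_linepath_ray[OF R c[of 0 ?b]] in_Q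
      by (simp add: eq_neg_iff_add_eq_0 add_eq_0_iff)
  qed
  have hyp: "norm (contour_integral (linepath (of_real R * \<i>) (of_real R * - 1)) H) \<le> B / (1 + R\<^sup>2 / 2) * (2 * R)"
    if R: "0 < R" for R
  proof -
    let ?a = "complex_of_real R * \<i>" and ?b = "complex_of_real R * - 1"
    have in_Q: "?a \<in> Q" "?b \<in> Q" using R by (auto simp: Q_def)
    have seg: "closed_segment ?a ?b \<subseteq> Q"
      using convex in_Q by (rule closed_segment_subset[rotated 2])
    have "norm (contour_integral (linepath ?a ?b) H) \<le> B / (1 + R\<^sup>2 / 2) * norm (?b - ?a)"
    proof (rule contour_integral_bound_linepath)
      show "H contour_integrable_on linepath ?a ?b"
        by (rule contour_integrable_continuous_linepath[OF continuous_on_subset[OF cont seg]])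
      fix s assume s: "s \<in> closed_segment ?a ?b"
      then obtain u where u: "0 \<le> u" "u \<le> 1" "s = (1 - u) *\<^sub>R ?a + u *\<^sub>R ?b"
        unfolding in_segment by blast
      have "Re s = - (u * R)" "Im s = (1 - u) * R" by (simp_all add: u(3))
      then have "(norm s)\<^sup>2 = R\<^sup>2 * ((1 - u)\<^sup>2 + u\<^sup>2)"
        unfolding cmod_power2 by (simp add: power_mult_distrib distrib_left mult.commute)
      also have "(1 - u)\<^sup>2 + u\<^sup>2 = 1 / 2 + 2 * (u - 1 / 2)\<^sup>2"
        by (simp add: power2_eq_square algebra_simps)
      also have "R\<^sup>2 * \<dots> \<ge> R\<^sup>2 * (1 / 2)" by (intro mult_left_mono) auto
      finally have "B / (1 + (norm s)\<^sup>2) \<le> B / (1 + R\<^sup>2 / 2)"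
        using assms(4) by (intro divide_left_mono) (auto intro!: mult_pos_pos add_pos_nonneg)
      then show "norm (H s) \<le> B / (1 + R\<^sup>2 / 2)" using bound[of s] s seg by force
    qed (use assms(4) in auto)
    also have "\<dots> \<le> B / (1 + R\<^sup>2 / 2) * (2 * R)"
      using norm_triangle_ineq4[of ?b ?a] R assms(4) by (intro mult_left_mono) (auto simp: norm_mult)
    finally show ?thesis .
  qed
  have "((\<lambda>R. contour_integral (linepath (of_real R * \<i>) (of_real R * - 1)) H) \<longlongrightarrow> 0) at_top"
  proof (rule Lim_null_comparison)
    show "\<forall>\<^sub>F R in at_top. norm (contour_integral (linepath (of_real R * \<i>) (of_real R * - 1)) H) \<le> B / (1 + R\<^sup>2 / 2) * (2 * R)"
      using eventually_gt_at_top[of 0] by eventually_elim (rule hyp)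
    show "((\<lambda>R. B / (1 + R\<^sup>2 / 2) * (2 * R)) \<longlongrightarrow> 0) at_top" by real_asymp
  qed
  then have "((\<lambda>R. \<i> * (LINT t:{0..R}|lborel. H (of_real t * \<i>)) + contour_integral (linepath (of_real R * \<i>) (of_real R * - 1)) H)
      \<longlongrightarrow> \<i> * (LINT t:{0..}|lborel. H (of_real t * \<i>)) + 0) at_top"
    by (intro tendsto_add tendsto_mult tendsto_const tendsto_set_lebesgue_integral_at_top i1) auto
  moreover have "\<forall>\<^sub>F R in at_top. \<i> * (LINT t:{0..R}|lborel. H (of_real t * \<i>)) + contour_integral (linepath (of_real R * \<i>) (of_real R * - 1)) H
      = - 1 * (LINT t:{0..R}|lborel. H (of_real t * - 1))"
    using eventually_gt_at_top[of 0] by eventually_elim (rule triangle)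
  ultimately have "((\<lambda>R. - 1 * (LINT t:{0..R}|lborel. H (of_real t * - 1))) \<longlongrightarrow> \<i> * (LINT t:{0..}|lborel. H (of_real t * \<i>)) + 0) at_top"
    by (rule Lim_transform_eventually)
  moreover have "((\<lambda>R. - 1 * (LINT t:{0..R}|lborel. H (of_real t * - 1))) \<longlongrightarrow> - 1 * (LINT t:{0..}|lborel. H (of_real t * - 1))) at_top"
    by (intro tendsto_mult tendsto_const tendsto_set_lebesgue_integral_at_top i2) auto
  ultimately have lim: "\<i> * (LINT t:{0..}|lborel. H (of_real t * \<i>)) + 0 = - 1 * (LINT t:{0..}|lborel. H (of_real t * - 1))"
    by (rule tendsto_unique[OF trivial_limit_at_top_linorder])
  show "set_integrable lborel {0<..} (\<lambda>t. H (of_real t * \<i>))"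
    "set_integrable lborel {0<..} (\<lambda>v. H (- of_real v))"
    "\<i> * (LINT t:{0<..}|lborel. H (of_real t * \<i>)) = - (LINT v:{0<..}|lborel. H (- of_real v))"
    using open_closed[OF i1] open_closed[OF i2] lim by simp_all
qed

section \<open>Densities from integrable characteristic functions\<close>

lemma integral_iexp_Icc:
  fixes a b t :: real
  assumes "a \<le> b" "t \<noteq> 0"
  shows "(LINT x|lborel. indicator {a..b} x *\<^sub>R iexp (- (t * x))) = (iexp (- (t * a)) - iexp (- (t * b))) / (\<i> * t)"
proof -
  have "(LINT x|lborel. indicator {a..b} x *\<^sub>R iexp (- (t * x))) =
     (- iexp (- (t * b)) / (\<i> * t)) - (- iexp (- (t * a)) / (\<i> * t))"
  proof (rule integral_FTC_atLeastAtMost[OF assms(1)])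
    fix x :: real
    have "((\<lambda>z. - exp (- (\<i> * t) * z) / (\<i> * t)) has_field_derivative exp (- (\<i> * t) * of_real x)) (at (of_real x))"
      using assms by (auto intro!: derivative_eq_intros)
    from has_vector_derivative_real_field[OF this]
    show "((\<lambda>x. - iexp (- (t * x)) / (\<i> * t)) has_vector_derivative iexp (- (t * x))) (at x within {a..b})"
      by (auto simp: mult.assoc intro: has_vector_derivative_at_within)
  qed (auto intro!: continuous_intros)
  then show ?thesis by (simp add: diff_divide_distrib)
qed

context real_distribution
begin

definition inversion_density :: "real \<Rightarrow> real" where
  "inversion_density x = Re (LINT t|lborel. iexp (- (t * x)) * char M t) / (2 * pi)"

context
  assumes integrable_char: "integrable lborel (char M)"
begin

text \<open>
  Everything below rests on dominated convergence with the integrable majorant \<open>\<bar>\<phi>\<bar>\<close>.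
\<close>

lemma integrable_iexp_char: "integrable lborel (\<lambda>t. iexp (- (t * x)) * char M t)"
  by (rule Bochner_Integration.integrable_bound[OF integrable_char]) (auto simp: norm_mult)

lemma isCont_inversion_density: "isCont inversion_density x"
  unfolding continuous_at_sequentially
proof safe
  fix X assume X: "X \<longlonglongrightarrow> x"
  have "(\<lambda>n. LINT t|lborel. iexp (- (t * X n)) * char M t) \<longlonglongrightarrow> (LINT t|lborel. iexp (- (t * x)) * char M t)"
    by (rule integral_dominated_convergence[where w="\<lambda>t. norm (char M t)"])
      (auto intro!: tendsto_intros X integrable_char simp: norm_mult)
  then show "(inversion_density \<circ> X) \<longlonglongrightarrow> inversion_density x"
    unfolding comp_def inversion_density_def by (intro tendsto_intros) auto
qed

lemma abs_inversion_density_le: "\<bar>inversion_density x\<bar> \<le> (LINT t|lborel. norm (char M t)) / (2 * pi)"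
proof -
  have "\<bar>Re (LINT t|lborel. iexp (- (t * x)) * char M t)\<bar> \<le> norm (LINT t|lborel. iexp (- (t * x)) * char M t)"
    by (rule abs_Re_le_cmod)
  also have "\<dots> \<le> (LINT t|lborel. norm (iexp (- (t * x)) * char M t))"
    by (rule integral_norm_bound)
  finally show ?thesis by (simp add: inversion_density_def divide_right_mono norm_mult)
qed

lemma inversion_density_measurable [measurable]: "inversion_density \<in> borel_measurable borel"
  by (auto intro!: borel_measurable_continuous_onI continuous_at_imp_continuous_on isCont_inversion_density)

lemma integrable_inversion_density_Icc: "integrable lborel (\<lambda>x. indicator {a..b} x *\<^sub>R inversion_density x)"
  using borel_integrable_atLeastAtMost'[of a b inversion_density]
  by (auto intro!: continuous_at_imp_continuous_on isCont_inversion_density simp: set_integrable_def)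

text \<open>
  In the inversion formula of Levy the kernel \<open>(e\<^bsup>-ita\<^esup> - e\<^bsup>-itb\<^esup>) / (it)\<close> is bounded by \<open>b - a\<close>, so for an
  integrable characteristic function the truncated integrals converge to an integral over the whole line.
  The kernel is itself the integral of \<open>e\<^bsup>-itx\<^esup>\<close> over \<open>x \<in> [a, b]\<close>, and Fubini brings out the density.
\<close>

lemma measure_Ioc_nonatoms:
  assumes ab: "a \<le> b" and "measure M {a} = 0" "measure M {b} = 0"
  shows "measure M {a<..b} = (LINT x|lborel. indicator {a..b} x *\<^sub>R inversion_density x)"
proof -
  define K where "K t = (iexp (- (t * a)) - iexp (- (t * b))) / (\<i> * t) * char M t" for t :: real
  define K' where "K' x t = (indicator {a..b} x *\<^sub>R iexp (- (t * x))) * char M t" for x t :: real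
  have [measurable]: "K \<in> borel_measurable borel" unfolding K_def by measurable
  have K: "norm (K t) \<le> (b - a) * norm (char M t)" if "t \<noteq> 0" for t
    unfolding K_def norm_mult
    using Levy_Inversion_aux2[of "- b" "- a" t] ab that by (intro mult_right_mono) auto
  have "(\<lambda>T. (CLBINT t=-real T..real T. K t)) \<longlonglongrightarrow> (LINT t|lborel. K t)"
  proof -
    have "(\<lambda>T. LINT t|lborel. indicator {-real T<..<real T} t *\<^sub>R K t) \<longlonglongrightarrow> (LINT t|lborel. K t)"
    proof (rule integral_dominated_convergence[where w="\<lambda>t. (b - a) * norm (char M t)"])
      show "AE t in lborel. (\<lambda>T. indicator {-real T<..<real T} t *\<^sub>R K t) \<longlonglongrightarrow> K t"
      proof (rule AE_I2)
        fix t :: real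
        obtain N where "\<bar>t\<bar> < real N" using reals_Archimedean2 by blast
        then have "K t = indicator {-real T<..<real T} t *\<^sub>R K t" if "N \<le> T" for T
          using that by (auto split: split_indicator)
        then have "\<forall>\<^sub>F T in sequentially. K t = indicator {-real T<..<real T} t *\<^sub>R K t"
          by (auto simp: eventually_sequentially)
        then show "(\<lambda>T. indicator {-real T<..<real T} t *\<^sub>R K t) \<longlonglongrightarrow> K t"
          by (rule Lim_transform_eventually[OF tendsto_const])
      qed
      show "AE t in lborel. norm (indicator {-real T<..<real T} t *\<^sub>R K t) \<le> (b - a) * norm (char M t)" for T
        using AE_lborel_singleton[of 0] by eventually_elim (use K ab in \<open>auto split: split_indicator\<close>)
    qed (use integrable_char in auto)
    then show ?thesis
      by (simp add: interval_lebesgue_integral_def set_lebesgue_integral_def einterval_eq)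
  qed
  then have "(\<lambda>T. 1 / (2 * pi) * (CLBINT t=-real T..real T. K t)) \<longlonglongrightarrow> 1 / (2 * pi) * (LINT t|lborel. K t)"
    by (intro tendsto_intros)
  then have "complex_of_real (measure M {a<..b}) = 1 / (2 * pi) * (LINT t|lborel. K t)"
    using Levy_Inversion[OF assms] unfolding K_def by (intro LIMSEQ_unique) auto
  also have "(LINT t|lborel. K t) = (LINT t|lborel. LINT x|lborel. K' x t)"
  proof (rule integral_cong_AE)
    show "AE t in lborel. K t = (LINT x|lborel. K' x t)"
      using AE_lborel_singleton[of 0]
    proof eventually_elim
      case (elim t)
      then show ?case
        unfolding K_def K'_def integral_iexp_Icc[OF ab elim, symmetric] by (simp only: integral_mult_left_zero)
    qed
  qed (auto simp: K'_def)
  also have "\<dots> = (LINT x|lborel. LINT t|lborel. K' x t)"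
  proof (rule lborel_pair.Fubini_integral, rule lborel_pair.Fubini_integrable)
    have "(\<lambda>x. LINT t|lborel. norm (K' x t)) = (\<lambda>x. indicator {a..b} x * (LINT t|lborel. norm (char M t)))"
      by (auto simp: K'_def fun_eq_iff norm_mult split: split_indicator)
    moreover have "integrable lborel (indicator {a..b} :: real \<Rightarrow> real)"
      using ab by (intro integrable_real_indicator) auto
    ultimately show "integrable lborel (\<lambda>x. LINT t|lborel. norm (case (x, t) of (x, t) \<Rightarrow> K' x t))"
      by simp
    show "AE x in lborel. integrable lborel (\<lambda>t. case (x, t) of (x, t) \<Rightarrow> K' x t)"
      using integrable_iexp_char by (auto simp: K'_def split: split_indicator)
  qed (auto simp: K'_def)
  finally have "measure M {a<..b} = Re (1 / (2 * pi) * (LINT x|lborel. LINT t|lborel. K' x t))"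
    by (metis Re_complex_of_real)
  also have "\<dots> = 1 / (2 * pi) * Re (LINT x|lborel. indicator {a..b} x *\<^sub>R (LINT t|lborel. iexp (- (t * x)) * char M t))"
    by (simp add: K'_def)
  also have "\<dots> = (LINT x|lborel. indicator {a..b} x *\<^sub>R inversion_density x)"
  proof -
    have c: "isCont (\<lambda>x. LINT t|lborel. iexp (- (t * x)) * char M t) x" for x
      unfolding continuous_at_sequentially comp_def
      by (auto intro!: tendsto_intros integral_dominated_convergence[where w="\<lambda>t. norm (char M t)"] integrable_char simp: norm_mult)
    have "continuous_on {a..b} (\<lambda>x. LINT t|lborel. iexp (- (t * x)) * char M t)"
      by (intro continuous_at_imp_continuous_on ballI c)
    from borel_integrable_atLeastAtMost'[OF this]
    have "integrable lborel (\<lambda>x. indicator {a..b} x *\<^sub>R (LINT t|lborel. iexp (- (t * x)) * char M t))"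
      unfolding set_integrable_def .
    from integral_Re[OF this] show ?thesis
      by (simp add: inversion_density_def)
  qed
  finally show ?thesis .
qed

lemma nonatom_between:
  assumes "x < (y::real)"
  obtains a where "x < a" "a < y" "measure M {a} = 0"
proof -
  obtain a where "a \<in> {x<..<y}" "a \<notin> {x. measure M {x} \<noteq> 0}"
    using open_minus_countable[OF countable_support, of "{x<..<y}"] assms by auto
  then show ?thesis by (intro that[of a]) auto
qed

lemma integral_Icc_inversion_density_le:
  assumes "a \<le> b" "\<And>x. x \<in> {a..b} \<Longrightarrow> inversion_density x \<le> c"
  shows "(LINT x|lborel. indicator {a..b} x *\<^sub>R inversion_density x) \<le> c * (b - a)"
proof -
  have "(LINT x|lborel. indicator {a..b} x *\<^sub>R inversion_density x) \<le> (LINT x|lborel. indicator {a..b} x *\<^sub>R c)"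
    by (intro integral_mono integrable_inversion_density_Icc)
      (use assms in \<open>auto split: split_indicator\<close>)
  then show ?thesis using assms(1) by (simp add: mult.commute)
qed

text \<open>
  Intervals with non-atomic end points shrink to the given point, and their measure is at most a constant
  times their length because the inversion density is bounded.
\<close>

lemma measure_singleton_eq_0: "measure M {x} = 0"
proof -
  define C where "C = (LINT t|lborel. norm (char M t)) / (2 * pi)"
  have C: "0 \<le> C" by (simp add: C_def)
  have "measure M {x} \<le> e" if "0 < e" for e
  proof -
    \<comment> \<open>an interval of length \<open>2 d\<close> has measure at most \<open>2 C d < e\<close>\<close>
    define d where "d = e / (2 * (C + 1))"
    have d: "0 < d" using that C by (simp add: d_def)
    obtain a where a: "x - d < a" "a < x" "measure M {a} = 0" using nonatom_between[of "x - d" x] d by auto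
    obtain b where b: "x < b" "b < x + d" "measure M {b} = 0" using nonatom_between[of x "x + d"] d by auto
    have "measure M {x} \<le> measure M {a<..b}" using a b by (intro finite_measure_mono) auto
    also have "\<dots> \<le> C * (b - a)"
      using a b abs_inversion_density_le integral_Icc_inversion_density_le[of a b C]
      unfolding C_def by (subst measure_Ioc_nonatoms) (simp_all add: abs_le_iff)
    also have "\<dots> \<le> C * (2 * d)" using a b C by (intro mult_left_mono) auto
    also have "\<dots> = e * (C / (C + 1))" using C by (simp add: d_def field_simps)
    also have "\<dots> \<le> e * 1" using that C by (intro mult_left_mono) auto
    finally show ?thesis by simp
  qed
  then show ?thesis by (metis field_le_epsilon add.left_neutral antisym measure_nonneg)
qed

lemma measure_Ioc_eq_integral:
  "a \<le> b \<Longrightarrow> measure M {a<..b} = (LINT x|lborel. indicator {a..b} x *\<^sub>R inversion_density x)"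
  using measure_Ioc_nonatoms measure_singleton_eq_0 by simp

text \<open>
  A negative value would, by continuity, give a short interval negative measure.
\<close>

lemma inversion_density_nonneg: "0 \<le> inversion_density x"
proof (rule ccontr)
  assume neg: "\<not> 0 \<le> inversion_density x"
  define c where "c = inversion_density x / 2"
  have c: "c < 0" "inversion_density x < c" using neg by (auto simp: c_def)
  have "\<forall>\<^sub>F y in at x. inversion_density y < c"
    using isCont_inversion_density[of x] c(2) unfolding isCont_def by (rule order_tendstoD(2))
  then obtain d where d: "0 < d" "\<And>y. y \<noteq> x \<Longrightarrow> dist y x < d \<Longrightarrow> inversion_density y < c"
    unfolding eventually_at by auto
  have "inversion_density y \<le> c" if "y \<in> {x..x + d / 2}" for y
    using d c that by (cases "y = x") (auto simp: dist_real_def intro!: less_imp_le[OF d(2)])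
  then have "(LINT y|lborel. indicator {x..x + d / 2} y *\<^sub>R inversion_density y) \<le> c * (x + d / 2 - x)"
    using d by (intro integral_Icc_inversion_density_le) auto
  then have "measure M {x<..x + d / 2} \<le> c * (x + d / 2 - x)"
    using d measure_Ioc_eq_integral[of x "x + d / 2"] by linarith
  moreover have "c * (x + d / 2 - x) < 0" using d c by (simp add: mult_neg_pos)
  ultimately show False using measure_nonneg[of M "{x<..x + d / 2}"] by linarith
qed

theorem density_inversion: "M = density lborel (\<lambda>x. ennreal (inversion_density x))"
proof (rule measure_eqI_generator_eq[where \<Omega>=UNIV])
  fix A assume "A \<in> range (\<lambda>(a, b). {a<..b::real})"
  then obtain a b where A: "A = {a<..b}" by auto
  show "emeasure M A = emeasure (density lborel (\<lambda>x. ennreal (inversion_density x))) A"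
  proof (cases "a \<le> b")
    case True
    have "emeasure (density lborel (\<lambda>x. ennreal (inversion_density x))) A =
       (\<integral>\<^sup>+x. ennreal (inversion_density x) * indicator {a<..b} x \<partial>lborel)"
      by (simp add: A emeasure_density)
    also have "\<dots> = (\<integral>\<^sup>+x. ennreal (indicator {a..b} x *\<^sub>R inversion_density x) \<partial>lborel)"
      using AE_lborel_singleton[of a]
      by (intro nn_integral_cong_AE, eventually_elim) (auto split: split_indicator)
    also have "\<dots> = ennreal (LINT x|lborel. indicator {a..b} x *\<^sub>R inversion_density x)"
      by (intro nn_integral_eq_integral integrable_inversion_density_Icc) (auto simp: inversion_density_nonneg)
    also have "\<dots> = emeasure M A"
      using measure_Ioc_eq_integral[OF True] by (simp add: A emeasure_eq_measure)
    finally show ?thesis ..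
  qed (simp add: A)
next
  show "(\<Union>i. {- real (i::nat)<..real i}) = UNIV"
    by (rule UN_Ioc_eq_UNIV)
qed (auto simp: borel_sigma_sets_Ioc Int_stable_def)

end
end

section \<open>Exponential transforms of tempered stable variables\<close>

context prob_space
begin

text \<open>
  Differentiation under the integral sign. The difference quotients near \<open>z\<close> are dominated by
  \<open>\<bar>y\<bar>\<close> times exponentials with exponents close to \<open>- Re z\<close>; the factor \<open>\<bar>y\<bar>\<close> costs a further small change
  of exponent, and the strict inequality \<open>a < Re z\<close> leaves room for both.
\<close>

lemma exp_transform_has_field_derivative:
  fixes Y :: "'a \<Rightarrow> real" and z :: complex
  assumes [measurable]: "random_variable borel Y"
    and int: "\<And>b. a < b \<Longrightarrow> integrable M (\<lambda>\<omega>. exp (- b * Y \<omega>))"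
    and z: "a < Re z"
  shows "((\<lambda>z. LINT \<omega>|M. exp (- z * of_real (Y \<omega>))) has_field_derivative
           (LINT \<omega>|M. - of_real (Y \<omega>) * exp (- z * of_real (Y \<omega>)))) (at z)"
proof -
  have int_exp: "integrable M (\<lambda>\<omega>. exp (- w * of_real (Y \<omega>)))" if "a < Re w" for w
    by (rule Bochner_Integration.integrable_bound[OF int[OF that]]) auto
  define b where "b = Re z"
  \<comment> \<open>Room for two steps of length \<open>\<delta>\<close> above \<open>a\<close>: one for the increment \<open>h\<close>, one for the factor \<open>\<bar>y\<bar>\<close>.\<close>
  define \<delta> where "\<delta> = (b - a) / 3"
  have \<delta>: "0 < \<delta>" "a < b - 2 * \<delta>" using z by (auto simp: \<delta>_def b_def field_simps)
  define W where "W y = (exp (- (b - 2 * \<delta>) * y) + 2 * exp (- b * y) + exp (- (b + 2 * \<delta>) * y)) / \<delta>" for y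
  have W: "integrable M (\<lambda>\<omega>. W (Y \<omega>))"
    unfolding W_def using \<delta> z
    by (intro integrable_divide_zero Bochner_Integration.integrable_add integrable_mult_right int) (auto simp: b_def)
  define q where "q h y = (exp (- (z + h) * of_real y) - exp (- z * of_real y)) / h" for h :: complex and y :: real
  have q_bound: "norm (q h y) \<le> W y" if "norm h \<le> \<delta>" "h \<noteq> 0" for h y
  proof -
    let ?E = "exp (- (b - \<delta>) * y) + exp (- (b + \<delta>) * y)"
    have "norm (exp (- (z + h) * of_real y) - exp (- z * of_real y)) \<le> \<bar>y\<bar> * ?E * norm (z + h - z)"
    proof (rule field_differentiable_bound[of "cball z \<delta>" "\<lambda>w. exp (- w * of_real y)" "\<lambda>w. - of_real y * exp (- w * of_real y)"])
      fix w assume w: "w \<in> cball z \<delta>"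
      show "((\<lambda>w. exp (- w * of_real y)) has_field_derivative - of_real y * exp (- w * of_real y)) (at w within cball z \<delta>)"
        by (auto intro!: derivative_eq_intros)
      have "\<bar>Re w - b\<bar> \<le> \<delta>"
        using w abs_Re_le_cmod[of "w - z"] by (simp add: b_def dist_norm norm_minus_commute)
      then have "- Re w * y \<le> - (b - \<delta>) * y \<or> - Re w * y \<le> - (b + \<delta>) * y"
        using mult_right_mono[of "- Re w" "- (b - \<delta>)" y] mult_right_mono_neg[of "- (b + \<delta>)" "- Re w" y]
        by (cases "0 \<le> y") (auto simp: abs_le_iff)
      then have "exp (- Re w * y) \<le> exp (- (b - \<delta>) * y) \<or> exp (- Re w * y) \<le> exp (- (b + \<delta>) * y)"
        by auto
      then have "exp (- Re w * y) \<le> ?E"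
        by (smt (verit) exp_ge_zero)
      then show "norm (- of_real y * exp (- w * of_real y)) \<le> \<bar>y\<bar> * ?E"
        by (simp add: norm_mult mult_left_mono)
    qed (use that \<delta> in \<open>auto simp: dist_norm\<close>)
    then have "norm (q h y) \<le> \<bar>y\<bar> * ?E"
      using that(2) by (simp add: q_def norm_divide divide_le_eq)
    also have "\<bar>y\<bar> \<le> (exp (\<delta> * y) + exp (- \<delta> * y)) / \<delta>"
    proof -
      have "\<delta> * \<bar>y\<bar> = \<bar>\<delta> * y\<bar>" using \<delta> by (simp add: abs_mult)
      also have "\<dots> \<le> exp (\<delta> * y) + exp (- \<delta> * y)"
        using exp_ge_add_one_self[of "\<delta> * y"] exp_ge_add_one_self[of "- (\<delta> * y)"] exp_gt_zero[of "\<delta> * y"] exp_gt_zero[of "- (\<delta> * y)"]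
        unfolding minus_mult_left[symmetric] by linarith
      finally have "\<delta> * \<bar>y\<bar> \<le> exp (\<delta> * y) + exp (- \<delta> * y)" .
      then show ?thesis using \<delta> by (simp add: pos_le_divide_eq mult.commute)
    qed
    also have "(exp (\<delta> * y) + exp (- \<delta> * y)) / \<delta> * ?E = W y"
      by (simp add: W_def divide_inverse algebra_simps exp_add[symmetric])
    finally show ?thesis by (simp add: mult_right_mono)
  qed
  have q_lim: "((\<lambda>h. q h y) \<longlongrightarrow> - of_real y * exp (- z * of_real y)) (at 0)" for y
  proof -
    have "((\<lambda>w. exp (- w * of_real y)) has_field_derivative - of_real y * exp (- z * of_real y)) (at z)"
      by (auto intro!: derivative_eq_intros)
    then show ?thesis unfolding DERIV_def q_def .
  qed
  have "((\<lambda>h. LINT \<omega>|M. q h (Y \<omega>)) \<longlongrightarrow> (LINT \<omega>|M. - of_real (Y \<omega>) * exp (- z * of_real (Y \<omega>)))) (at 0)"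
    unfolding tendsto_at_iff_sequentially
  proof (intro allI impI)
    fix h :: "nat \<Rightarrow> complex" assume h: "\<forall>i. h i \<in> UNIV - {0}" "h \<longlonglongrightarrow> 0"
    have "\<forall>\<^sub>F i in sequentially. norm (h i) < \<delta>"
      using h(2) \<delta>(1) by (simp add: tendsto_iff)
    then obtain N where N: "\<And>i. N \<le> i \<Longrightarrow> norm (h i) < \<delta>"
      by (auto simp: eventually_sequentially)
    have "(\<lambda>i. LINT \<omega>|M. q (h (i + N)) (Y \<omega>)) \<longlonglongrightarrow> (LINT \<omega>|M. - of_real (Y \<omega>) * exp (- z * of_real (Y \<omega>)))"
    proof (rule integral_dominated_convergence[OF _ _ W])
      show "AE \<omega> in M. (\<lambda>i. q (h (i + N)) (Y \<omega>)) \<longlonglongrightarrow> - of_real (Y \<omega>) * exp (- z * of_real (Y \<omega>))"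
      proof (rule AE_I2)
        fix \<omega>
        have "((\<lambda>h. q h (Y \<omega>)) \<circ> h) \<longlonglongrightarrow> - of_real (Y \<omega>) * exp (- z * of_real (Y \<omega>))"
          using q_lim[of "Y \<omega>"] h unfolding tendsto_at_iff_sequentially by blast
        then show "(\<lambda>i. q (h (i + N)) (Y \<omega>)) \<longlonglongrightarrow> - of_real (Y \<omega>) * exp (- z * of_real (Y \<omega>))"
          unfolding comp_def by (rule LIMSEQ_ignore_initial_segment)
      qed
      show "AE \<omega> in M. norm (q (h (i + N)) (Y \<omega>)) \<le> W (Y \<omega>)" for i
        using q_bound[of "h (i + N)"] N[of "i + N"] h(1) by (auto intro!: AE_I2 less_imp_le)
    qed (auto simp: q_def)
    then show "((\<lambda>h. LINT \<omega>|M. q h (Y \<omega>)) \<circ> h) \<longlonglongrightarrow> (LINT \<omega>|M. - of_real (Y \<omega>) * exp (- z * of_real (Y \<omega>)))"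
      unfolding comp_def by (rule LIMSEQ_offset)
  qed
  moreover have "\<forall>\<^sub>F h in at 0. (LINT \<omega>|M. q h (Y \<omega>)) =
      ((LINT \<omega>|M. exp (- (z + h) * of_real (Y \<omega>))) - (LINT \<omega>|M. exp (- z * of_real (Y \<omega>)))) / h"
    unfolding eventually_at
  proof (intro exI[of _ \<delta>] conjI ballI impI)
    fix h :: complex assume h: "h \<noteq> 0 \<and> dist h 0 < \<delta>"
    have "a < Re (z + h)"
      using h abs_Re_le_cmod[of h] \<delta> by (simp add: b_def abs_le_iff)
    then show "(LINT \<omega>|M. q h (Y \<omega>)) =
      ((LINT \<omega>|M. exp (- (z + h) * of_real (Y \<omega>))) - (LINT \<omega>|M. exp (- z * of_real (Y \<omega>)))) / h"
      unfolding q_def using int_exp[of z] int_exp[of "z + h"] z by simp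
  qed (use \<delta> in auto)
  ultimately show ?thesis
    unfolding DERIV_def by (rule Lim_transform_eventually)
qed

text \<open>
  Both sides are holomorphic and agree on the positive real axis. The parameter \<open>a\<close> is \<open>0\<close> when only
  positivity of \<open>Y\<close> is known, and \<open>- lam\<close> when all exponential moments exist.
\<close>

lemma tempered_stable_transform:
  fixes z :: complex
  assumes "0 < lam" "positive_tempered_stable lam \<beta> Y"
    and "- lam \<le> a" "a \<le> 0"
    and int: "\<And>b. a < b \<Longrightarrow> integrable M (\<lambda>\<omega>. exp (- b * Y \<omega>))"
    and z: "a < Re z"
  shows "(LINT \<omega>|M. exp (- z * of_real (Y \<omega>))) = exp (of_real (lam powr \<beta>) - (z + of_real lam) powr of_real \<beta>)"
proof -
  have Y[measurable]: "random_variable borel Y"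
    and L: "\<And>s. 0 \<le> s \<Longrightarrow> expectation (\<lambda>\<omega>. exp (- s * Y \<omega>)) = exp (- ((s + lam) powr \<beta> - lam powr \<beta>))"
    using assms(2) by (auto simp: positive_tempered_stable_def)
  define f where "f z = (LINT \<omega>|M. exp (- z * of_real (Y \<omega>))) - exp (of_real (lam powr \<beta>) - (z + of_real lam) powr of_real \<beta>)" for z :: complex
  have "f z = 0"
  proof (rule analytic_continuation[of f "{z. a < Re z}" "of_real ` {0<..}" 1])
    have "(\<lambda>z. LINT \<omega>|M. exp (- z * of_real (Y \<omega>))) holomorphic_on {z. a < Re z}"
      using exp_transform_has_field_derivative[OF Y int] 
      by (subst holomorphic_on_open) (auto simp: open_halfspace_Re_gt)
    moreover have "(\<lambda>z. exp (of_real (lam powr \<beta>) - (z + of_real lam) powr of_real \<beta>)) holomorphic_on {z. a < Re z}"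
      using assms(3) by (intro holomorphic_intros) (auto simp: complex_nonpos_Reals_iff)
    ultimately show "f holomorphic_on {z. a < Re z}"
      unfolding f_def by (rule holomorphic_on_diff)
    show "open {z. a < Re z}" by (rule open_halfspace_Re_gt)
    show "connected {z. a < Re z}" by (intro convex_connected convex_halfspace_Re_gt)
    show "complex_of_real ` {0<..} \<subseteq> {z. a < Re z}" using assms(4) by auto
    show "1 \<in> {z. a < Re z}" using assms(4) by auto
    show "(1::complex) islimpt complex_of_real ` {0<..}"
      unfolding islimpt_sequential
    proof (intro exI[of _ "\<lambda>n. of_real (1 + inverse (real (Suc n)))"] conjI allI)
      have "(\<lambda>n. complex_of_real (1 + inverse (real (Suc n)))) \<longlonglongrightarrow> of_real (1 + 0)"
        by (intro tendsto_intros LIMSEQ_inverse_real_of_nat)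
      then show "(\<lambda>n. complex_of_real (1 + inverse (real (Suc n)))) \<longlonglongrightarrow> 1" by simp
      show "complex_of_real (1 + inverse (real (Suc n))) \<in> complex_of_real ` {0<..} - {1}" for n
      proof -
        have "0 < 1 + inverse (real (Suc n))" "1 + inverse (real (Suc n)) \<noteq> 1"
          by (auto simp: add_pos_pos)
        then show ?thesis by (metis DiffI greaterThan_iff imageI of_real_eq_1_iff singletonD)
      qed
    qed
    fix w assume "w \<in> complex_of_real ` {0<..}"
    then obtain s where s: "w = of_real s" "0 < s" by auto
    have "(LINT \<omega>|M. exp (- w * of_real (Y \<omega>))) = (LINT \<omega>|M. complex_of_real (exp (- s * Y \<omega>)))"
      by (simp add: s exp_of_real[symmetric])
    also have "\<dots> = of_real (exp (- ((s + lam) powr \<beta> - lam powr \<beta>)))"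
      using L[of s] s by (simp add: integral_complex_of_real)
    also have "\<dots> = exp (of_real (lam powr \<beta>) - of_real ((s + lam) powr \<beta>))"
      by (simp add: exp_of_real[symmetric])
    also have "complex_of_real ((s + lam) powr \<beta>) = (w + of_real lam) powr of_real \<beta>"
      using s assms(1) powr_of_real[of "s + lam" \<beta>] by simp
    finally show "f w = 0" by (simp add: f_def)
  qed (use z in auto)
  then show ?thesis by (simp add: f_def)
qed

text \<open>
  The boundary case \<open>Re z = 0\<close>, reached from the right by dominated convergence.
\<close>

lemma char_tempered_stable:
  assumes "0 < lam" "positive_tempered_stable lam \<beta> Y"
  shows "char (distr M borel Y) t = exp (of_real (lam powr \<beta>) - (of_real lam - \<i> * of_real t) powr of_real \<beta>)"
proof -
  have Y[measurable]: "random_variable borel Y" and pos: "AE \<omega> in M. 0 < Y \<omega>"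
    using assms(2) by (auto simp: positive_tempered_stable_def)
  have int: "integrable M (\<lambda>\<omega>. exp (- b * Y \<omega>))" if "0 < b" for b
    using pos that by (intro integrable_const_bound[of _ 1]) auto
  \<comment> \<open>approach \<open>- i t\<close> horizontally from the right half plane\<close>
  define z where "z n = Complex (inverse (real (Suc n))) (- t)" for n
  have z: "z \<longlonglongrightarrow> - \<i> * of_real t"
    unfolding z_def Complex_eq
    by (rule tendsto_eq_intros LIMSEQ_inverse_real_of_nat refl | simp)+
  have "(\<lambda>n. LINT \<omega>|M. exp (- z n * of_real (Y \<omega>))) \<longlonglongrightarrow> (LINT \<omega>|M. exp (- (- \<i> * of_real t) * of_real (Y \<omega>)))"
  proof (rule integral_dominated_convergence[where w="\<lambda>_. 1"])
    show "AE \<omega> in M. norm (exp (- z n * of_real (Y \<omega>))) \<le> 1" for n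
      using pos by eventually_elim (simp add: z_def)
    show "AE \<omega> in M. (\<lambda>n. exp (- z n * of_real (Y \<omega>))) \<longlonglongrightarrow> exp (- (- \<i> * of_real t) * of_real (Y \<omega>))"
      by (intro AE_I2 tendsto_intros z)
  qed auto
  moreover have "(\<lambda>n. LINT \<omega>|M. exp (- z n * of_real (Y \<omega>))) \<longlonglongrightarrow>
     exp (of_real (lam powr \<beta>) - (- \<i> * of_real t + of_real lam) powr of_real \<beta>)"
  proof -
    have "(LINT \<omega>|M. exp (- z n * of_real (Y \<omega>))) = exp (of_real (lam powr \<beta>) - (z n + of_real lam) powr of_real \<beta>)" for n
      using assms by (intro tempered_stable_transform[where a=0] int) (auto simp: z_def)
    moreover have "(\<lambda>n. exp (of_real (lam powr \<beta>) - (z n + of_real lam) powr of_real \<beta>)) \<longlonglongrightarrow>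
       exp (of_real (lam powr \<beta>) - (- \<i> * of_real t + of_real lam) powr of_real \<beta>)"
      using assms(1) by (intro tendsto_intros tendsto_powr_complex z) (auto simp: complex_nonpos_Reals_iff)
    ultimately show ?thesis by simp
  qed
  ultimately have "(LINT \<omega>|M. exp (- (- \<i> * of_real t) * of_real (Y \<omega>))) =
     exp (of_real (lam powr \<beta>) - (- \<i> * of_real t + of_real lam) powr of_real \<beta>)"
    by (rule LIMSEQ_unique)
  then show ?thesis
    unfolding char_def by (subst integral_distr) (auto simp: algebra_simps)
qed

text \<open>
  Otherwise the transform would be differentiable at \<open>- lam\<close>, but its difference quotients to the right
  of \<open>- lam\<close> are those of \<open>c exp (- (h powr \<beta>))\<close> at \<open>h = 0\<close>, which tend to \<open>- \<infinity>\<close> because \<open>\<beta> < 1\<close>.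
\<close>

lemma tempered_stable_not_all_exp_moments:
  assumes "0 < lam" "0 < \<beta>" "\<beta> < 1" "positive_tempered_stable lam \<beta> Y"
  shows "\<exists>b. \<not> integrable M (\<lambda>\<omega>. exp (- b * Y \<omega>))"
proof (rule ccontr)
  assume "\<not> ?thesis"
  then have int: "integrable M (\<lambda>\<omega>. exp (- b * Y \<omega>))" for b by simp
  have Y[measurable]: "random_variable borel Y"
    using assms(4) by (auto simp: positive_tempered_stable_def)
  define L where "L z = (LINT \<omega>|M. exp (- z * of_real (Y \<omega>)))" for z :: complex
  define D :: complex where "D = (LINT \<omega>|M. - of_real (Y \<omega>) * exp (- (- of_real lam) * of_real (Y \<omega>)))"
  have deriv: "(L has_field_derivative D) (at (- of_real lam))"
    unfolding L_def D_def by (rule exp_transform_has_field_derivative[OF Y int, of "- lam - 1"]) auto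
  define c where "c = exp (lam powr \<beta>)"
  have L_right: "L (- of_real lam + of_real h) = of_real (c * exp (- (h powr \<beta>)))" if "0 < h" for h
    using that assms tempered_stable_transform[OF assms(1,4), of "- lam" "- of_real lam + of_real h"] int
    by (simp add: L_def c_def exp_diff exp_minus exp_of_real[symmetric] powr_of_real divide_inverse)
  have right: "filterlim (\<lambda>h. complex_of_real h) (at 0) (at_right 0)"
    unfolding filterlim_at by (auto intro!: tendsto_eq_intros simp: eventually_at_filter)
  have "((\<lambda>h. L (- of_real lam + of_real h)) \<longlongrightarrow> L (- of_real lam)) (at_right 0)"
    using DERIV_isCont[OF deriv] unfolding isCont_def by (auto intro!: isCont_tendsto_compose[OF DERIV_isCont[OF deriv]] tendsto_eq_intros)
  moreover have "\<forall>\<^sub>F h in at_right 0. L (- of_real lam + of_real h) = of_real (c * exp (- (h powr \<beta>)))"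
    using eventually_at_right_less[of 0] by eventually_elim (rule L_right)
  ultimately have "((\<lambda>h. complex_of_real (c * exp (- (h powr \<beta>)))) \<longlongrightarrow> L (- of_real lam)) (at_right 0)"
    by (rule Lim_transform_eventually)
  moreover have "((\<lambda>h. h powr \<beta>) \<longlongrightarrow> 0) (at_right 0)"
    using assms by real_asymp
  then have "((\<lambda>h. complex_of_real (c * exp (- (h powr \<beta>)))) \<longlongrightarrow> of_real (c * exp (- 0))) (at_right 0)"
    by (intro tendsto_intros)
  ultimately have "L (- of_real lam) = of_real (c * exp (- 0))"
    by (rule tendsto_unique[OF trivial_limit_at_right_real])
  then have L0: "L (- of_real lam) = of_real c" by simp
  have "((\<lambda>h. (L (- of_real lam + of_real h) - L (- of_real lam)) / of_real h) \<longlongrightarrow> D) (at_right 0)"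
    using filterlim_compose[OF deriv[unfolded DERIV_def] right] .
  moreover have "\<forall>\<^sub>F h in at_right 0. (L (- of_real lam + of_real h) - L (- of_real lam)) / of_real h
      = of_real ((c * exp (- (h powr \<beta>)) - c) / h)"
    using eventually_at_right_less[of 0] by eventually_elim (simp only: L_right L0 of_real_diff of_real_divide)
  ultimately have "((\<lambda>h. complex_of_real ((c * exp (- (h powr \<beta>)) - c) / h)) \<longlongrightarrow> D) (at_right 0)"
    by (rule Lim_transform_eventually)
  from tendsto_Re[OF this] have "((\<lambda>h. (c * exp (- (h powr \<beta>)) - c) / h) \<longlongrightarrow> Re D) (at_right 0)" by simp
  moreover have "filterlim (\<lambda>h. (c * exp (- (h powr \<beta>)) - c) / h) at_bot (at_right 0)"
    using assms unfolding c_def by real_asymp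
  ultimately show False
    using not_tendsto_and_filterlim_at_infinity[of "at_right (0::real)"] filterlim_at_bot_imp_at_infinity trivial_limit_at_right_real by blast
qed

lemma indep_var_nn_integral_mult:
  assumes "indep_var borel (Y :: 'a \<Rightarrow> real) borel (Z :: 'a \<Rightarrow> real)"
    and [measurable]: "f \<in> borel_measurable borel" "g \<in> borel_measurable borel"
  shows "(\<integral>\<^sup>+\<omega>. f (Y \<omega>) * g (Z \<omega>) \<partial>M) = (\<integral>\<^sup>+\<omega>. f (Y \<omega>) \<partial>M) * (\<integral>\<^sup>+\<omega>. g (Z \<omega>) \<partial>M)"
proof -
  have [measurable]: "random_variable borel Y" "random_variable borel Z"
    using assms(1) by (auto dest: indep_var_rv1 indep_var_rv2)
  interpret Y: prob_space "distr M borel Y" by (rule prob_space_distr) simp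
  interpret Z: prob_space "distr M borel Z" by (rule prob_space_distr) simp
  have "(\<integral>\<^sup>+\<omega>. f (Y \<omega>) * g (Z \<omega>) \<partial>M) = (\<integral>\<^sup>+p. f (fst p) * g (snd p) \<partial>distr M (borel \<Otimes>\<^sub>M borel) (\<lambda>\<omega>. (Y \<omega>, Z \<omega>)))"
    by (subst nn_integral_distr) auto
  also have "distr M (borel \<Otimes>\<^sub>M borel) (\<lambda>\<omega>. (Y \<omega>, Z \<omega>)) = distr M borel Y \<Otimes>\<^sub>M distr M borel Z"
    using assms(1) indep_var_distribution_eq by metis
  also have "(\<integral>\<^sup>+p. f (fst p) * g (snd p) \<partial>(distr M borel Y \<Otimes>\<^sub>M distr M borel Z)) =
      (\<integral>\<^sup>+y. (\<integral>\<^sup>+z. f y * g z \<partial>distr M borel Z) \<partial>distr M borel Y)"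
    by (subst Z.nn_integral_fst[symmetric]) auto
  also have "\<dots> = (\<integral>\<^sup>+\<omega>. f (Y \<omega>) \<partial>M) * (\<integral>\<^sup>+\<omega>. g (Z \<omega>) \<partial>M)"
    by (simp add: nn_integral_cmult nn_integral_multc nn_integral_distr)
  finally show ?thesis .
qed

end


section \<open>The law of the innovation\<close>

context prob_space
begin

lemma tempered_stable_nn_transform:
  assumes "positive_tempered_stable lam \<beta> Y" "0 \<le> s"
  shows "(\<integral>\<^sup>+\<omega>. ennreal (exp (- s * Y \<omega>)) \<partial>M) = ennreal (exp (- ((s + lam) powr \<beta> - lam powr \<beta>)))"
proof -
  have L: "expectation (\<lambda>\<omega>. exp (- s * Y \<omega>)) = exp (- ((s + lam) powr \<beta> - lam powr \<beta>))"
    using assms by (auto simp: positive_tempered_stable_def)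
  then have "integrable M (\<lambda>\<omega>. exp (- s * Y \<omega>))"
    using not_integrable_integral_eq by fastforce
  then show ?thesis by (simp add: nn_integral_eq_integral L[simplified])
qed

text \<open>
  The transform identity is stated in \<open>[0, \<infinity>]\<close>, so that it can be used before any of the
  moments is known to be finite.
\<close>

lemma ar_nn_transform:
  assumes "indep_var borel Z borel Y" and "random_variable borel X"
    and AR: "AE \<omega> in M. X \<omega> = \<rho> * Y \<omega> + Z \<omega>"
  shows "(\<integral>\<^sup>+\<omega>. ennreal (exp (- s * X \<omega>)) \<partial>M) =
    (\<integral>\<^sup>+\<omega>. ennreal (exp (- s * Z \<omega>)) \<partial>M) * (\<integral>\<^sup>+\<omega>. ennreal (exp (- (s * \<rho>) * Y \<omega>)) \<partial>M)"
proof -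
  have "(\<integral>\<^sup>+\<omega>. ennreal (exp (- s * X \<omega>)) \<partial>M) =
      (\<integral>\<^sup>+\<omega>. ennreal (exp (- s * Z \<omega>)) * ennreal (exp (- (s * \<rho>) * Y \<omega>)) \<partial>M)"
    using AR by (intro nn_integral_cong_AE, eventually_elim)
      (simp add: ennreal_mult[symmetric] exp_add[symmetric] algebra_simps)
  also have "\<dots> = (\<integral>\<^sup>+\<omega>. ennreal (exp (- s * Z \<omega>)) \<partial>M) * (\<integral>\<^sup>+\<omega>. ennreal (exp (- (s * \<rho>) * Y \<omega>)) \<partial>M)"
    by (rule indep_var_nn_integral_mult[OF assms(1)]) auto
  finally show ?thesis .
qed

text \<open>
  If \<open>\<rho> < 0\<close>, then \<open>E e\<^bsup>- s X\<^esup> = E e\<^bsup>- s Z\<^esup> E e\<^bsup>s \<bar>\<rho>\<bar> Y\<^esup>\<close> is finite and \<open>E e\<^bsup>- s Z\<^esup>\<close> is positive for all \<open>s \<ge> 0\<close>, which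
  makes every exponential moment of \<open>Y\<close> finite.
\<close>

lemma ar_coefficient_nonneg:
  assumes "0 < lam" "0 < \<beta>" "\<beta> < 1"
    and X: "positive_tempered_stable lam \<beta> X" and Y: "positive_tempered_stable lam \<beta> Y"
    and indep: "indep_var borel Z borel Y"
    and AR: "AE \<omega> in M. X \<omega> = \<rho> * Y \<omega> + Z \<omega>"
  shows "0 \<le> \<rho>"
proof (rule ccontr)
  assume "\<not> 0 \<le> \<rho>"
  then have \<rho>: "\<rho> < 0" by simp
  have [measurable]: "random_variable borel X" "random_variable borel Y" "random_variable borel Z"
    using X Y indep by (auto simp: positive_tempered_stable_def dest: indep_var_rv1)
  have pos: "AE \<omega> in M. 0 < Y \<omega>" using Y by (auto simp: positive_tempered_stable_def)
  have int: "integrable M (\<lambda>\<omega>. exp (- b * Y \<omega>))" for b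
  proof (cases "0 \<le> b")
    case True
    then show ?thesis using pos by (intro integrable_const_bound[of _ 1]) auto
  next
    case False
    define s where "s = b / \<rho>"
    have s: "0 \<le> s" "s * \<rho> = b" using False \<rho> by (auto simp: s_def divide_nonpos_nonpos)
    have "(\<integral>\<^sup>+\<omega>. ennreal (exp (- s * Z \<omega>)) \<partial>M) * (\<integral>\<^sup>+\<omega>. ennreal (exp (- b * Y \<omega>)) \<partial>M) \<noteq> top"
      using ar_nn_transform[OF indep _ AR, of s] tempered_stable_nn_transform[OF X s(1)] s(2) by simp
    moreover have "(\<integral>\<^sup>+\<omega>. ennreal (exp (- s * Z \<omega>)) \<partial>M) \<noteq> 0"
      by (subst nn_integral_0_iff_AE) auto
    ultimately have "(\<integral>\<^sup>+\<omega>. ennreal (exp (- b * Y \<omega>)) \<partial>M) \<noteq> top"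
      by (auto simp: ennreal_mult_eq_top_iff)
    then show ?thesis
      by (intro integrableI_nonneg) (auto simp: less_top)
  qed
  show False
    using tempered_stable_not_all_exp_moments[OF assms(1-3) Y] int by blast
qed

text \<open>
  The transform of \<open>Z\<close> at \<open>s \<ge> 0\<close> is a quotient of values of a decreasing function, hence at most \<open>1\<close>.
  By Markov's inequality \<open>P (Z \<le> - \<delta>) \<le> e\<^bsup>- \<delta> s\<^esup>\<close> for all \<open>s\<close>.
\<close>

lemma innovation_nonneg:
  assumes "0 < lam" "0 < \<beta>" "\<beta> < 1" "0 < \<rho>" "\<rho> < 1"
    and X: "positive_tempered_stable lam \<beta> X" and Y: "positive_tempered_stable lam \<beta> Y"
    and indep: "indep_var borel Z borel Y"
    and AR: "AE \<omega> in M. X \<omega> = \<rho> * Y \<omega> + Z \<omega>"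
  shows "AE \<omega> in M. 0 \<le> Z \<omega>"
proof -
  have [measurable]: "random_variable borel X" "random_variable borel Z"
    using X indep by (auto simp: positive_tempered_stable_def dest: indep_var_rv1)
  have le1: "(\<integral>\<^sup>+\<omega>. ennreal (exp (- s * Z \<omega>)) \<partial>M) \<le> 1" if s: "0 \<le> s" for s
  proof -
    let ?c = "ennreal (exp (- ((s * \<rho> + lam) powr \<beta> - lam powr \<beta>)))"
    have "(s * \<rho> + lam) powr \<beta> \<le> (s + lam) powr \<beta>"
      using assms s by (intro powr_mono2) (auto simp: mult_left_le)
    then have "(\<integral>\<^sup>+\<omega>. ennreal (exp (- s * Z \<omega>)) \<partial>M) * ?c \<le> 1 * ?c"
      using ar_nn_transform[OF indep _ AR, of s] tempered_stable_nn_transform[OF X s]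
        tempered_stable_nn_transform[OF Y, of "s * \<rho>"] assms s
      by (auto simp: ennreal_le_iff)
    then show ?thesis
      by (subst (asm) (1 2) mult.commute) (subst (asm) ennreal_mult_le_mult_iff, auto)
  qed
  have "AE \<omega> in M. - \<delta> < Z \<omega>" if \<delta>: "0 < \<delta>" for \<delta>
  proof -
    have "emeasure M {\<omega> \<in> space M. Z \<omega> \<le> - \<delta>} \<le> ennreal (exp (- (\<delta> * real n)))" for n
    proof -
      have "emeasure M {\<omega> \<in> space M. Z \<omega> \<le> - \<delta>} = (\<integral>\<^sup>+\<omega>. indicator {\<omega> \<in> space M. Z \<omega> \<le> - \<delta>} \<omega> \<partial>M)"
        by simp
      also have "\<dots> \<le> (\<integral>\<^sup>+\<omega>. ennreal (exp (- (\<delta> * real n))) * ennreal (exp (- real n * Z \<omega>)) \<partial>M)"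
      proof (rule nn_integral_mono)
        fix \<omega>
        show "indicator {\<omega> \<in> space M. Z \<omega> \<le> - \<delta>} \<omega> \<le> ennreal (exp (- (\<delta> * real n))) * ennreal (exp (- real n * Z \<omega>))"
        proof (cases "Z \<omega> \<le> - \<delta>")
          case True
          then have "real n * Z \<omega> \<le> real n * - \<delta>" by (intro mult_left_mono) auto
          then have "1 \<le> exp (- (\<delta> * real n)) * exp (- real n * Z \<omega>)"
            by (simp add: exp_add[symmetric] mult.commute)
          then show ?thesis
            by (auto split: split_indicator simp: ennreal_mult[symmetric] simp flip: ennreal_1 intro!: ennreal_leI)
        qed auto
      qed
      also have "\<dots> = ennreal (exp (- (\<delta> * real n))) * (\<integral>\<^sup>+\<omega>. ennreal (exp (- real n * Z \<omega>)) \<partial>M)"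
        by (rule nn_integral_cmult) simp
      also have "\<dots> \<le> ennreal (exp (- (\<delta> * real n))) * 1"
        by (intro mult_left_mono le1) auto
      finally show ?thesis by simp
    qed
    moreover have "(\<lambda>n. ennreal (exp (- (\<delta> * real n)))) \<longlonglongrightarrow> ennreal 0"
      using \<delta> by (intro tendsto_ennrealI) real_asymp
    ultimately have "emeasure M {\<omega> \<in> space M. Z \<omega> \<le> - \<delta>} \<le> ennreal 0"
      by (intro LIMSEQ_le_const) auto
    then show ?thesis
      by (subst AE_iff_measurable[OF _ refl]) (auto simp: not_less)
  qed
  then have "AE \<omega> in M. \<forall>n. - inverse (real (Suc n)) < Z \<omega>"
    by (subst AE_all_countable) auto
  then show ?thesis
  proof eventually_elim
    case (elim \<omega>)
    show ?case
    proof (rule ccontr)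
      assume "\<not> 0 \<le> Z \<omega>"
      then obtain n where "inverse (real (Suc n)) < - Z \<omega>"
        using reals_Archimedean[of "- Z \<omega>"] by auto
      then show False using elim[rule_format, of n] by simp
    qed
  qed
qed

text \<open>
  The characteristic function at \<open>t\<close> is the transform at \<open>- i t\<close>, and that of \<open>Y\<close> has no zeros, so one may divide.
  For \<open>t \<le> 0\<close> the point \<open>- i t\<close> lies in the closed upper half plane.
\<close>

lemma char_innovation:
  assumes "0 < lam"
    and X: "positive_tempered_stable lam \<beta> X" and Y: "positive_tempered_stable lam \<beta> Y"
    and indep: "indep_var borel Z borel Y"
    and AR: "AE \<omega> in M. X \<omega> = \<rho> * Y \<omega> + Z \<omega>"
  shows "char (distr M borel Z) t = innovation_laplace lam \<beta> \<rho> (- of_real t * \<i>)"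
proof -
  have [measurable]: "random_variable borel X" "random_variable borel Y" "random_variable borel Z"
    using X Y indep by (auto simp: positive_tempered_stable_def dest: indep_var_rv1)
  have "indep_var borel (id \<circ> Z) borel ((\<lambda>y. \<rho> * y) \<circ> Y)"
    by (rule indep_var_compose[OF indep]) auto
  then have indep': "indep_var borel Z borel (\<lambda>\<omega>. \<rho> * Y \<omega>)" by (simp add: comp_def)
  have "distr M borel X = distr M borel (\<lambda>\<omega>. Z \<omega> + \<rho> * Y \<omega>)"
    using AR by (intro distr_cong_AE) (auto simp: add.commute)
  then have "char (distr M borel X) t = char (distr M borel Z) t * char (distr M borel (\<lambda>\<omega>. \<rho> * Y \<omega>)) t"
    using char_distr_add[OF indep'] by simp
  also have "char (distr M borel (\<lambda>\<omega>. \<rho> * Y \<omega>)) t = char (distr M borel Y) (\<rho> * t)"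
    unfolding char_def by (subst (1 2) integral_distr) (auto simp: mult_ac)
  finally have "exp (of_real (lam powr \<beta>) - (of_real lam - \<i> * of_real t) powr of_real \<beta>) =
     char (distr M borel Z) t * exp (of_real (lam powr \<beta>) - (of_real lam - \<i> * of_real (\<rho> * t)) powr of_real \<beta>)"
    using char_tempered_stable[OF assms(1) X] char_tempered_stable[OF assms(1) Y] by simp
  then have "char (distr M borel Z) t =
      exp (of_real (lam powr \<beta>) - (of_real lam - \<i> * of_real t) powr of_real \<beta>) /
      exp (of_real (lam powr \<beta>) - (of_real lam - \<i> * of_real (\<rho> * t)) powr of_real \<beta>)"
    by (simp add: eq_divide_eq)
  also have "\<dots> = innovation_laplace lam \<beta> \<rho> (- of_real t * \<i>)"
    by (simp add: exp_diff[symmetric] innovation_laplace_def algebra_simps)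
  finally show ?thesis .
qed

end

section \<open>The density as an integral over the cut\<close>

lemma char_minus: "char M (- t) = cnj (char M t)"
  unfolding char_def by (subst Bochner_Integration.integral_cnj[symmetric]) (simp add: exp_cnj)

lemma integral_even:
  fixes r :: "real \<Rightarrow> real"
  assumes r: "integrable lborel r" and even: "\<And>t. r (- t) = r t"
  shows "(LINT t|lborel. r t) = 2 * (LINT t:{0<..}|lborel. r t)"
proof -
  have i: "integrable lborel (\<lambda>t. indicator {0<..} t *\<^sub>R r t)" "integrable lborel (\<lambda>t. indicator {..<0} t *\<^sub>R r t)"
    by (auto intro!: integrable_mult_indicator r simp del: real_scaleR_def)
  have "(LINT t|lborel. r t) = (LINT t|lborel. indicator {0<..} t *\<^sub>R r t + indicator {..<0} t *\<^sub>R r t)"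
    using AE_lborel_singleton[of 0] r
    by (intro integral_cong_AE) (auto elim!: eventually_mono split: split_indicator)
  also have "\<dots> = (LINT t|lborel. indicator {0<..} t *\<^sub>R r t) + (LINT t|lborel. indicator {..<0} t *\<^sub>R r t)"
    using i by (rule Bochner_Integration.integral_add)
  also have "(LINT t|lborel. indicator {..<0} t *\<^sub>R r t) = (LINT t|lborel. indicator {0<..} t *\<^sub>R r t)"
    by (subst lborel_integral_real_affine[of "-1" _ 0])
      (auto simp: even intro!: Bochner_Integration.integral_cong split: split_indicator)
  finally show ?thesis by (simp add: set_lebesgue_integral_def)
qed

lemma set_integral_lborel_shift:
  fixes f :: "real \<Rightarrow> 'b :: {banach, second_countable_topology}"
  assumes "\<And>w. w \<in> A \<longleftrightarrow> a + w \<in> B" "\<And>w. w \<in> A \<Longrightarrow> h w = f (a + w)"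
  shows "set_integrable lborel A h \<longleftrightarrow> set_integrable lborel B f"
    and "(LINT w:A|lborel. h w) = (LINT v:B|lborel. f v)"
proof -
  have eq: "(\<lambda>w. indicator A w *\<^sub>R h w) = (\<lambda>w. indicator B (a + 1 * w) *\<^sub>R f (a + 1 * w))"
    using assms by (auto simp: fun_eq_iff split: split_indicator)
  show "set_integrable lborel A h \<longleftrightarrow> set_integrable lborel B f"
    unfolding set_integrable_def eq by (rule lborel_integrable_real_affine_iff) simp
  show "(LINT w:A|lborel. h w) = (LINT v:B|lborel. f v)"
    unfolding set_lebesgue_integral_def eq by (subst lborel_integral_real_affine[of 1 _ a]) auto
qed

text \<open>
  The integrands of the two cut integrals are jumps \<open>z - cnj z\<close>, because the boundary values on the two sides
  of the cut are complex conjugates.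
\<close>

lemma diff_cnj_eq_Im: "z - cnj z = 2 * \<i> * of_real (Im z)"
  by (simp add: complex_eq_iff)

lemma powr_above_eq: "powr_above y \<beta> = complex_of_real y powr of_real \<beta>"
  by (cases "y = 0") (simp add: powr_above_def, rule powr_above_eq_powr)

lemma TAR1_integrand2_eq:
  assumes "v = lam + w"
  shows "TAR1_integrand2 lam \<beta> \<rho> x w =
     2 * \<i> * of_real (Im (exp (- of_real v * of_real x) * innovation_laplace lam \<beta> \<rho> (- of_real v)))"
proof -
  let ?z = "exp (- of_real v * of_real x) * innovation_laplace lam \<beta> \<rho> (- of_real v)"
  have "?z = of_real (exp (- lam * x)) * of_real (exp (- w * x)) *
       exp (powr_above (- lam * \<rho> - \<rho> * w + lam) \<beta> - powr_above (- w) \<beta>)"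
    unfolding innovation_laplace_def powr_above_eq assms
    by (simp add: exp_of_real[symmetric] exp_add[symmetric] algebra_simps)
  then have "TAR1_integrand2 lam \<beta> \<rho> x w = ?z - cnj ?z"
    by (simp add: TAR1_integrand2_def powr_below_eq_cnj exp_cnj)
  also have "\<dots> = 2 * \<i> * of_real (Im ?z)" by (rule diff_cnj_eq_Im)
  finally show ?thesis .
qed

lemma TAR1_integrand1_eq:
  assumes "0 < \<rho>" "0 < w" "v = lam / \<rho> + w"
  shows "TAR1_integrand1 lam \<beta> \<rho> x w =
     2 * \<i> * of_real (Im (exp (- of_real v * of_real x) * innovation_laplace lam \<beta> \<rho> (- of_real v)))"
proof -
  let ?z = "exp (- of_real v * of_real x) * innovation_laplace lam \<beta> \<rho> (- of_real v)"
  have "of_real \<rho> * (- of_real v) + of_real lam = complex_of_real (- (\<rho> * w))"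
    using assms by (simp add: algebra_simps)
  moreover have "complex_of_real (- (\<rho> * w)) powr of_real \<beta> =
      (of_real \<rho> powr of_real \<beta>) * of_real (w powr \<beta>) * exp (\<i> * of_real (pi * \<beta>))"
    using assms unfolding powr_above_eq[symmetric]
    by (simp add: powr_above_def powr_mult powr_of_real)
  moreover have "- of_real v + of_real lam = complex_of_real (- w + lam - lam / \<rho>)"
    using assms by simp
  ultimately have "innovation_laplace lam \<beta> \<rho> (- of_real v) =
      exp ((of_real \<rho> powr of_real \<beta>) * of_real (w powr \<beta>) * exp (\<i> * of_real (pi * \<beta>))
            - powr_above (- w + lam - lam / \<rho>) \<beta>)"
    unfolding innovation_laplace_def powr_above_eq by (simp only:)
  moreover have "exp (- complex_of_real v * of_real x) = of_real (exp (- lam * x / \<rho>)) * of_real (exp (- w * x))"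
    using assms by (simp add: exp_of_real[symmetric] exp_add[symmetric] algebra_simps)
  ultimately have "?z = of_real (exp (- lam * x / \<rho>)) * of_real (exp (- w * x)) *
       exp ((of_real \<rho> powr of_real \<beta>) * of_real (w powr \<beta>) * exp (\<i> * of_real (pi * \<beta>))
            - powr_above (- w + lam - lam / \<rho>) \<beta>)" by simp
  then have "TAR1_integrand1 lam \<beta> \<rho> x w = ?z - cnj ?z"
    using assms(1) by (simp add: TAR1_integrand1_def powr_below_eq_cnj exp_cnj powr_of_real)
  also have "\<dots> = 2 * \<i> * of_real (Im ?z)" by (rule diff_cnj_eq_Im)
  finally show ?thesis .
qed

text \<open>
  On \<open>[- lam, 0)\<close> both powers have a nonnegative base, so there is no jump.
\<close>

lemma Im_innovation_laplace_before_cut: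
  assumes "0 < \<rho>" "\<rho> < 1" "0 < v" "v \<le> lam"
  shows "Im (exp (- of_real v * of_real x) * innovation_laplace lam \<beta> \<rho> (- of_real v)) = 0"
proof -
  have "\<rho> * v \<le> v" using assms by (intro mult_left_le_one_le) auto
  then have "\<rho> * v \<le> lam" using assms by linarith
  then have "(of_real \<rho> * (- of_real v) + of_real lam) powr of_real \<beta> = complex_of_real ((lam - \<rho> * v) powr \<beta>)"
    "(- of_real v + of_real lam) powr of_real \<beta> = complex_of_real ((lam - v) powr \<beta>)"
    using assms powr_of_real[of "lam - \<rho> * v" \<beta>] powr_of_real[of "lam - v" \<beta>] by (simp_all add: algebra_simps)
  then have "exp (- of_real v * of_real x) * innovation_laplace lam \<beta> \<rho> (- of_real v) =
      complex_of_real (exp (- v * x) * exp ((lam - \<rho> * v) powr \<beta> - (lam - v) powr \<beta>))"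
    by (simp add: innovation_laplace_def exp_of_real[symmetric])
  then show ?thesis by (simp only: Im_complex_of_real)
qed

lemma innovation_laplace_rotation:
  assumes "0 < lam" "0 < \<beta>" "\<beta> < 1" "0 < \<rho>" "\<rho> < 1" "0 < x"
  defines "H \<equiv> \<lambda>s. exp (s * of_real x) * innovation_laplace lam \<beta> \<rho> s"
  shows "set_integrable lborel {0<..} (\<lambda>t. H (of_real t * \<i>))"
    and "set_integrable lborel {0<..} (\<lambda>v. H (- of_real v))"
    and "\<i> * (LINT t:{0<..}|lborel. H (of_real t * \<i>)) = - (LINT v:{0<..}|lborel. H (- of_real v))"
proof -
  obtain B where "0 \<le> B" and B: "\<And>s. Re s \<le> 0 \<Longrightarrow> 0 \<le> Im s \<Longrightarrow>
      norm (H s) \<le> B / (1 + (norm s)\<^sup>2)"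
    unfolding H_def using innovation_laplace_decay[OF assms(1-6)] by metis
  have bound: "norm (H s) \<le> B / (1 + (norm s)\<^sup>2)" if "s \<in> {s. Re s \<le> 0} \<inter> {s. 0 \<le> Im s}" for s
    using that by (intro B) auto
  have cont: "continuous_on ({s. Re s \<le> 0} \<inter> {s. 0 \<le> Im s}) H"
    unfolding H_def using assms
    by (intro continuous_intros continuous_on_subset[OF continuous_on_innovation_laplace]) auto
  have "interior ({s. Re s \<le> 0} \<inter> {s. 0 \<le> Im s}) \<subseteq> {s. 0 < Im s}"
    using interior_halfspace_ge[of \<i> 0] by (auto simp: interior_Int)
  then have diff: "H field_differentiable at s" if "s \<in> interior ({s. Re s \<le> 0} \<inter> {s. 0 \<le> Im s})" for s
    unfolding H_def using that assms(4)
    by (intro field_differentiable_mult innovation_laplace_differentiable)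
       (auto intro!: holomorphic_on_imp_differentiable_at[of _ UNIV] holomorphic_intros)
  show "set_integrable lborel {0<..} (\<lambda>t. H (of_real t * \<i>))"
    "set_integrable lborel {0<..} (\<lambda>v. H (- of_real v))"
    "\<i> * (LINT t:{0<..}|lborel. H (of_real t * \<i>)) = - (LINT v:{0<..}|lborel. H (- of_real v))"
    by (rule quadrant_rotation[OF cont diff \<open>0 \<le> B\<close> bound]; assumption)+
qed

text \<open>
  On the imaginary axis \<open>e\<^bsup>sx\<^esup>\<close> has modulus 1, so the decay bound, taken with \<open>x = 1\<close>, is one for \<open>F\<close>.
\<close>

lemma integrable_innovation_char:
  assumes "0 < lam" "0 < \<beta>" "\<beta> < 1" "0 < \<rho>" "\<rho> < 1" "real_distribution \<mu>"
    and char: "\<And>t. char \<mu> t = innovation_laplace lam \<beta> \<rho> (- of_real t * \<i>)"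
  shows "integrable lborel (char \<mu>)"
proof -
  interpret real_distribution \<mu> by fact
  obtain B where B: "\<And>s. Re s \<le> 0 \<Longrightarrow> 0 \<le> Im s \<Longrightarrow>
      norm (exp (s * of_real 1) * innovation_laplace lam \<beta> \<rho> s) \<le> B / (1 + (norm s)\<^sup>2)"
    using innovation_laplace_decay[OF assms(1-5), of 1] by auto
  have nonpos: "norm (char \<mu> t) \<le> B / (1 + t\<^sup>2)" if "t \<le> 0" for t
    using B[of "- of_real t * \<i>"] that by (simp add: char norm_mult)
  have bound: "norm (char \<mu> t) \<le> B / (1 + t\<^sup>2)" for t
  proof (cases "t \<le> 0")
    case False
    then show ?thesis using nonpos[of "- t"] by (simp add: char_minus)
  qed (rule nonpos)
  have "integrable lborel (\<lambda>t::real. B * inverse (1 + t\<^sup>2))"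
    using integrable_inverse_1_plus_square by (simp add: set_integrable_def)
  then show ?thesis
    by (rule Bochner_Integration.integrable_bound)
      (auto intro!: AE_I2 order_trans[OF bound] simp: divide_inverse)
qed

text \<open>
  The integrand of the inversion formula at \<open>- t\<close> is \<open>H (i t)\<close>, where \<open>H s = e\<^bsup>sx\<^esup> F(s)\<close>, and the conjugate of
  its value at \<open>t\<close>. So the real part of the inversion integral is twice that of \<open>\<integral> H (i t) dt\<close> over \<open>t > 0\<close>, which
  is the imaginary part of the integral of \<open>H\<close> along the positive imaginary axis and can be rotated.
\<close>

lemma inversion_density_innovation:
  assumes "0 < lam" "0 < \<beta>" "\<beta> < 1" "0 < \<rho>" "\<rho> < 1" "0 < x"
    and \<mu>: "real_distribution \<mu>"
    and char: "\<And>t. char \<mu> t = innovation_laplace lam \<beta> \<rho> (- of_real t * \<i>)"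
  shows "real_distribution.inversion_density \<mu> x =
    - (LINT v:{0<..}|lborel. Im (exp (- of_real v * of_real x) * innovation_laplace lam \<beta> \<rho> (- of_real v))) / pi"
proof -
  interpret real_distribution \<mu> by fact
  define H where "H s = exp (s * of_real x) * innovation_laplace lam \<beta> \<rho> s" for s
  note rot = innovation_laplace_rotation[OF assms(1-6), folded H_def]
  have int: "integrable lborel (\<lambda>t. iexp (- (t * x)) * char \<mu> t)"
    using integrable_innovation_char[OF assms(1-5) \<mu> char] by (rule integrable_iexp_char)
  have at_neg: "iexp (- (- t * x)) * char \<mu> (- t) = H (of_real t * \<i>)" for t
    by (simp add: H_def char mult_ac)
  have conj: "iexp (- (- t * x)) * char \<mu> (- t) = cnj (iexp (- (t * x)) * char \<mu> t)" for t
    by (simp add: char_minus exp_cnj)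
  have "Re (LINT t|lborel. iexp (- (t * x)) * char \<mu> t) = (LINT t|lborel. Re (iexp (- (t * x)) * char \<mu> t))"
    using int by (rule integral_Re[symmetric])
  also have "\<dots> = 2 * (LINT t:{0<..}|lborel. Re (iexp (- (t * x)) * char \<mu> t))"
    using int by (intro integral_even integrable_Re) (simp_all only: conj cnj.sel)
  also have "(LINT t:{0<..}|lborel. Re (iexp (- (t * x)) * char \<mu> t)) = (LINT t:{0<..}|lborel. Re (H (of_real t * \<i>)))"
    by (simp only: at_neg[symmetric] conj cnj.sel)
  also have "\<dots> = Re (LINT t:{0<..}|lborel. H (of_real t * \<i>))"
    using integral_Re[OF rot(1)[unfolded set_integrable_def]] by (simp add: set_lebesgue_integral_def)
  also have "\<dots> = Im (\<i> * (LINT t:{0<..}|lborel. H (of_real t * \<i>)))" by simp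
  also have "\<dots> = - Im (LINT v:{0<..}|lborel. H (- of_real v))" by (simp only: rot(3) uminus_complex.sel)
  also have "Im (LINT v:{0<..}|lborel. H (- of_real v)) = (LINT v:{0<..}|lborel. Im (H (- of_real v)))"
    using integral_Im[OF rot(2)[unfolded set_integrable_def]] by (simp add: set_lebesgue_integral_def)
  finally show ?thesis by (simp add: inversion_density_def H_def)
qed

text \<open>
  The substitutions \<open>v = lam / \<rho> + w\<close> and \<open>v = lam + w\<close> turn the two integrals into integrals of one and the same
  jump \<open>J v\<close> at \<open>- v\<close>, over the two consecutive intervals that make up \<open>v > lam\<close>.
\<close>

lemma cut_integral_split:
  assumes "0 < lam" "0 < \<beta>" "\<beta> < 1" "0 < \<rho>" "\<rho> < 1" "0 < x"
  shows "interval_lebesgue_integrable lborel 0 \<infinity> (TAR1_integrand1 lam \<beta> \<rho> x)"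
    and "interval_lebesgue_integrable lborel 0 (ereal (lam / \<rho> - lam)) (TAR1_integrand2 lam \<beta> \<rho> x)"
    and "(LBINT w=0..\<infinity>. TAR1_integrand1 lam \<beta> \<rho> x w) + (LBINT w=0..ereal (lam / \<rho> - lam). TAR1_integrand2 lam \<beta> \<rho> x w)
      = 2 * \<i> * of_real (LINT v:{0<..}|lborel. Im (exp (- of_real v * of_real x) * innovation_laplace lam \<beta> \<rho> (- of_real v)))"
proof -
  define I where "I v = Im (exp (- of_real v * of_real x) * innovation_laplace lam \<beta> \<rho> (- of_real v))" for v
  define J where "J v = 2 * \<i> * complex_of_real (I v)" for v
  have lam: "0 < lam" "lam < lam / \<rho>" using assms by (auto simp: less_divide_eq)
  have I: "set_integrable lborel {0<..} I"
    using integrable_Im[OF innovation_laplace_rotation(2)[OF assms, unfolded set_integrable_def]]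
    by (simp add: set_integrable_def I_def)
  then have "integrable lborel (\<lambda>v. complex_of_real (indicator {0<..} v *\<^sub>R I v))"
    unfolding set_integrable_def by (rule integrable_of_real)
  then have "set_integrable lborel {0<..} (\<lambda>v. complex_of_real (I v))"
    by (simp add: set_integrable_def scaleR_conv_of_real)
  then have J: "set_integrable lborel {0<..} J"
    unfolding J_def by (intro set_integrable_mult_right) auto
  have J1: "set_integrable lborel {lam / \<rho><..} J" and J2: "set_integrable lborel {lam<..<lam / \<rho>} J"
    using lam by (auto intro!: set_integrable_subset[OF J])
  have t1: "TAR1_integrand1 lam \<beta> \<rho> x w = J (lam / \<rho> + w)" if "w \<in> {0<..}" for w
    using TAR1_integrand1_eq[of \<rho> w _ lam \<beta> x] assms that by (simp add: J_def I_def)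
  have t2: "TAR1_integrand2 lam \<beta> \<rho> x w = J (lam + w)" for w
    using TAR1_integrand2_eq[of _ lam w] by (simp add: J_def I_def)
  have s1: "set_integrable lborel {0<..} (TAR1_integrand1 lam \<beta> \<rho> x)"
    "(LINT w:{0<..}|lborel. TAR1_integrand1 lam \<beta> \<rho> x w) = (LINT v:{lam / \<rho><..}|lborel. J v)"
    using set_integral_lborel_shift[of "{0<..}" "lam / \<rho>" "{lam / \<rho><..}" "TAR1_integrand1 lam \<beta> \<rho> x" J] t1 J1
    by auto
  have s2: "set_integrable lborel {0<..<lam / \<rho> - lam} (TAR1_integrand2 lam \<beta> \<rho> x)"
    "(LINT w:{0<..<lam / \<rho> - lam}|lborel. TAR1_integrand2 lam \<beta> \<rho> x w) = (LINT v:{lam<..<lam / \<rho>}|lborel. J v)"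
    using set_integral_lborel_shift[of "{0<..<lam / \<rho> - lam}" lam "{lam<..<lam / \<rho>}" "TAR1_integrand2 lam \<beta> \<rho> x" J] t2 J2
    by (auto simp: algebra_simps)
  show "interval_lebesgue_integrable lborel 0 \<infinity> (TAR1_integrand1 lam \<beta> \<rho> x)"
    using s1(1) by (simp add: interval_lebesgue_integrable_def zero_ereal_def)
  show "interval_lebesgue_integrable lborel 0 (ereal (lam / \<rho> - lam)) (TAR1_integrand2 lam \<beta> \<rho> x)"
    using s2(1) lam by (simp add: interval_lebesgue_integrable_def zero_ereal_def)
  have "(LINT v:{0<..}|lborel. J v) = (LINT v|lborel. indicator {lam / \<rho><..} v *\<^sub>R J v + indicator {lam<..<lam / \<rho>} v *\<^sub>R J v)"
    unfolding set_lebesgue_integral_def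
  proof (rule integral_cong_AE)
    show "AE v in lborel. indicator {0<..} v *\<^sub>R J v = indicator {lam / \<rho><..} v *\<^sub>R J v + indicator {lam<..<lam / \<rho>} v *\<^sub>R J v"
      using AE_lborel_singleton[of "lam / \<rho>"]
    proof eventually_elim
      case (elim v)
      have "J v = 0" if "0 < v" "v \<le> lam"
        using Im_innovation_laplace_before_cut[OF assms(4,5) that] by (simp add: J_def I_def)
      then show ?case using lam elim by (auto split: split_indicator)
    qed
  qed (use J J1 J2 in \<open>auto simp: set_integrable_def\<close>)
  also have "\<dots> = (LINT v:{lam / \<rho><..}|lborel. J v) + (LINT v:{lam<..<lam / \<rho>}|lborel. J v)"
    using J1 J2 unfolding set_lebesgue_integral_def set_integrable_def by (rule Bochner_Integration.integral_add)
  finally have "(LBINT w=0..\<infinity>. TAR1_integrand1 lam \<beta> \<rho> x w) + (LBINT w=0..ereal (lam / \<rho> - lam). TAR1_integrand2 lam \<beta> \<rho> x w)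
      = (LINT v:{0<..}|lborel. J v)"
    using s1(2) s2(2) lam by (simp add: interval_lebesgue_integral_def zero_ereal_def)
  also have "\<dots> = 2 * \<i> * of_real (LINT v:{0<..}|lborel. I v)"
    unfolding J_def by (simp add: set_integral_complex_of_real)
  finally show "(LBINT w=0..\<infinity>. TAR1_integrand1 lam \<beta> \<rho> x w) + (LBINT w=0..ereal (lam / \<rho> - lam). TAR1_integrand2 lam \<beta> \<rho> x w)
      = 2 * \<i> * of_real (LINT v:{0<..}|lborel. Im (exp (- of_real v * of_real x) * innovation_laplace lam \<beta> \<rho> (- of_real v)))"
    by (simp add: I_def)
qed

theorem theorem2p1:
  fixes M :: "'a measure"
    and X \<epsilon> :: "nat \<Rightarrow> 'a \<Rightarrow> real"
    and lam \<beta> \<rho> :: real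
  assumes "prob_space M"
    and "lam > 0" and "0 < \<beta>" and "\<beta> < 1" and "\<bar>\<rho>\<bar> < 1" and "\<rho> \<noteq> 0"
    and "prob_space.TAR1 M lam \<beta> \<rho> X \<epsilon>"
  shows "\<exists>g :: real \<Rightarrow> real.
    (\<forall>x. 0 \<le> g x) \<and> (\<forall>x\<le>0. g x = 0) \<and>
    (\<forall>n\<ge>1. distributed M lborel (\<epsilon> n) (\<lambda>x. ennreal (g x))) \<and>
    (\<forall>x>0.
       interval_lebesgue_integrable lborel 0 \<infinity> (TAR1_integrand1 lam \<beta> \<rho> x) \<and>
       interval_lebesgue_integrable lborel 0 (ereal (lam / \<rho> - lam)) (TAR1_integrand2 lam \<beta> \<rho> x) \<and>
       complex_of_real (g x) =
         - (1 / (2 * of_real pi * \<i>) * (LBINT w=0..\<infinity>. TAR1_integrand1 lam \<beta> \<rho> x w)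
            + 1 / (2 * of_real pi * \<i>) *
                (LBINT w=0..ereal (lam / \<rho> - lam). TAR1_integrand2 lam \<beta> \<rho> x w)))"
proof -
  interpret prob_space M by fact
  have TAR1: "iid_from_1 \<epsilon>" "AE \<omega> in M. X 1 \<omega> = \<rho> * X 0 \<omega> + \<epsilon> 1 \<omega>"
    "indep_var borel (\<epsilon> 1) borel (X 0)"
    "positive_tempered_stable lam \<beta> (X 1)" "positive_tempered_stable lam \<beta> (X 0)"
    using assms(7) unfolding TAR1_def by (force)+
  have "0 \<le> \<rho>"
    using ar_coefficient_nonneg[OF assms(2-4) TAR1(4,5,3,2)] .
  then have \<rho>: "0 < \<rho>" "\<rho> < 1" using assms(5,6) by auto
  note par = assms(2-4) \<rho>
  \<comment> \<open>All innovations have this law, so its density serves for every \<open>n\<close>.\<close>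
  define \<mu> where "\<mu> = distr M borel (\<epsilon> 1)"
  have rv[measurable]: "random_variable borel (\<epsilon> 1)" using TAR1(3) by (rule indep_var_rv1)
  interpret \<mu>: real_distribution \<mu> unfolding \<mu>_def by (rule real_distribution_distr[OF rv])
  have char: "char \<mu> t = innovation_laplace lam \<beta> \<rho> (- of_real t * \<i>)" for t
    unfolding \<mu>_def by (rule char_innovation[OF assms(2) TAR1(4,5,3,2)])
  have int: "integrable lborel (char \<mu>)"
    by (rule integrable_innovation_char[OF par \<mu>.real_distribution_axioms char])
  note [measurable] = \<mu>.inversion_density_measurable[OF int]
  define g where "g x = (if 0 < x then \<mu>.inversion_density x else 0)" for x
  have [measurable]: "g \<in> borel_measurable borel" unfolding g_def by measurable
  have nonneg: "0 \<le> g x" for x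
    using \<mu>.inversion_density_nonneg[OF int] by (simp add: g_def)
  have \<mu>_density: "\<mu> = density lborel (\<lambda>x. ennreal (g x))"
  proof -
    \<comment> \<open>The inversion density vanishes almost everywhere on the left half line, where \<open>g\<close> is set to zero.\<close>
    have "AE x in \<mu>. 0 \<le> x"
      unfolding \<mu>_def using innovation_nonneg[OF par TAR1(4,5,3,2)] by (subst AE_distr_iff[OF rv]) simp_all
    then have "AE x in lborel. 0 < ennreal (\<mu>.inversion_density x) \<longrightarrow> 0 \<le> x"
      by (subst (asm) \<mu>.density_inversion[OF int]) (subst (asm) AE_density, auto)
    then have "AE x in lborel. ennreal (\<mu>.inversion_density x) = ennreal (g x)"
      using AE_lborel_singleton[of 0]
      by eventually_elim (use \<mu>.inversion_density_nonneg[OF int] in \<open>auto simp: g_def less_le\<close>)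
    then have "density lborel (\<lambda>x. ennreal (\<mu>.inversion_density x)) = density lborel (\<lambda>x. ennreal (g x))"
      by (intro density_cong) measurable
    with \<mu>.density_inversion[OF int] show ?thesis by (rule trans)
  qed
  show ?thesis
  proof (rule exI[of _ g], intro conjI allI impI)
    fix n :: nat assume n: "1 \<le> n"
    have "distr M borel (\<epsilon> n) = \<mu>"
      using TAR1(1) n unfolding iid_from_1_def \<mu>_def by blast
    moreover have "indep_vars (\<lambda>_. borel) \<epsilon> {1..}"
      using TAR1(1) unfolding iid_from_1_def by blast
    then have "random_variable borel (\<epsilon> n)"
      using n by (simp add: indep_vars_def)
    moreover have "distr M lborel (\<epsilon> n) = distr M borel (\<epsilon> n)" by (intro distr_cong) auto
    ultimately show "distributed M lborel (\<epsilon> n) (\<lambda>x. ennreal (g x))"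
      using \<mu>_density by (simp add: distributed_def)
  next
    fix x :: real assume x: "0 < x"
    note cut = cut_integral_split[OF par x]
    show "interval_lebesgue_integrable lborel 0 \<infinity> (TAR1_integrand1 lam \<beta> \<rho> x)"
      "interval_lebesgue_integrable lborel 0 (ereal (lam / \<rho> - lam)) (TAR1_integrand2 lam \<beta> \<rho> x)"
      by (fact cut)+
    define I where "I = (LINT v:{0<..}|lborel. Im (exp (- of_real v * of_real x) * innovation_laplace lam \<beta> \<rho> (- of_real v)))"
    have "g x = - I / pi"
      using x inversion_density_innovation[OF par x \<mu>.real_distribution_axioms char] by (simp add: g_def I_def)
    moreover have "1 / (2 * of_real pi * \<i>) * (2 * \<i> * complex_of_real I) = of_real (I / pi)"
      by simp
    ultimately show "complex_of_real (g x) =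
         - (1 / (2 * of_real pi * \<i>) * (LBINT w=0..\<infinity>. TAR1_integrand1 lam \<beta> \<rho> x w)
            + 1 / (2 * of_real pi * \<i>) *
                (LBINT w=0..ereal (lam / \<rho> - lam). TAR1_integrand2 lam \<beta> \<rho> x w))"
      unfolding distrib_left[symmetric] cut(3) I_def[symmetric] by simp
  qed (use nonneg in \<open>auto simp: g_def\<close>)
qed

end
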